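(* Let $n\geq 1$ and $r\geq 1$. The $\mathbf{Z}_n$-vector bundle $V_{r,\infty}\times_{U(r)}\mathbf{C}^r\to G_{r,\infty}$ associated with the principal $(\mathbf{Z}_n;U(r))$-bundle $V_{r,\infty}\to G_{r,\infty}$ is equivalent, as a $\mathbf{Z}_n$-vector bundle over $G_{r,\infty}$, to the canonical bundle $E_{\mathbf{M}}\to G_{r,\infty}$.
   Context: $\mathbf{Z}_n$ is the cyclic group of order $n$, identified with the group of complex $n$-th roots of unity. A $(\mathbf{Z}_n;U(r))$-bundle is a principal $U(r)$-bundle on which $\mathbf{Z}_n$ acts by bundle maps. Let $\mathbf{C}^\infty=\bigcup_{s\geq 1}\mathbf{C}^s$. $V_{r,\infty}=\varinjlim_s V_{r,s}$ (direct limit topology), where $V_{r,s}$ is the space of $r$-tuples $(v_1,\dots,v_r)$ of vectors in $\mathbf{C}^s$ with $v_i\cdot v_j=\delta_{ij}$ for the standard Hermitian product. The group $\mathbf{Z}_n\times U(r)$ acts on the left on $V_{r,\infty}$ by $(\gamma,a)\cdot(v_1,\dots,v_r)=(w_1,\dots,w_r)$, with $w_j^k=\gamma^k\sum_{i=1}^r\overline{a_{ji}}\,v_i^k$, where $v_i^k$ is the $k$-th coordinate of $v_i$. Let $\mathbf{M}$ be the $\mathbf{Z}_n$-module $\mathbf{M}=\mathbf{C}^\infty$ with $\gamma\cdot(z_1,z_2,\dots)=(\gamma z_1,\gamma^2z_2,\dots)$. $G_{r,\infty}$ is the Grassmannian of $r$-dimensional subspaces of $\mathbf{M}$, with the induced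 $\mathbf{Z}_n$-action. The right $U(r)$-action on $V_{r,\infty}$ defined by $(v_1,\dots,v_r)\cdot a=(1,a^{-1})\cdot(v_1,\dots,v_r)$ has quotient space $V_{r,\infty}/U(r)=G_{r,\infty}$, via $(v_1,\dots,v_r)\mapsto\langle v_1,\dots,v_r\rangle$ (the linear span). The canonical $\mathbf{Z}_n$-vector bundle on $G_{r,\infty}$ has total space $E_{\mathbf{M}}=\{(N,z): z\in N\}\subseteq G_{r,\infty}\times\mathbf{M}$, with projection $(N,z)\mapsto N$ and the $\mathbf{Z}_n$-action induced from $G_{r,\infty}\times\mathbf{M}$. The associated bundle has total space $V_{r,\infty}\times_{U(r)}\mathbf{C}^r$ (the quotient of $V_{r,\infty}\times\mathbf{C}^r$ by $(v\cdot a,y)\sim(v,ay)$) with $\mathbf{Z}_n$-action $\gamma\cdot[(v_1,\dots,v_r),y]=[(\gamma,\mathbf{I}_r)\cdot(v_1,\dots,v_r),y]$. *)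

theory Defs
  imports "HOL-Analysis.Analysis" "HOL-Library.Function_Algebras"
begin

section \<open>Colimit topologies\<close>

definition direct_limit_topology :: "(nat \<Rightarrow> 'a topology) \<Rightarrow> 'a topology" where
  "direct_limit_topology X = topology (\<lambda>U. U \<subseteq> (\<Union>s. topspace (X s)) \<and>
     (\<forall>s. openin (X s) (U \<inter> topspace (X s))))"

definition quotient_topology :: "'a topology \<Rightarrow> ('a \<Rightarrow> 'b) \<Rightarrow> 'b set \<Rightarrow> 'b topology" where
  "quotient_topology X f S = topology (\<lambda>U. U \<subseteq> S \<and> openin X {x \<in> topspace X. f x \<in> U})"

lemma openin_direct_limit_topology:
  "openin (direct_limit_topology X) U \<longleftrightarrow>
     U \<subseteq> (\<Union>s. topspace (X s)) \<and> (\<forall>s. openin (X s) (U \<inter> topspace (X s)))"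
proof -
  have "istopology (\<lambda>U. U \<subseteq> (\<Union>s. topspace (X s)) \<and> (\<forall>s. openin (X s) (U \<inter> topspace (X s))))"
    unfolding istopology_def
  proof (intro conjI allI impI)
    fix S T s
    assume S: "S \<subseteq> (\<Union>s. topspace (X s)) \<and> (\<forall>s. openin (X s) (S \<inter> topspace (X s)))"
      and T: "T \<subseteq> (\<Union>s. topspace (X s)) \<and> (\<forall>s. openin (X s) (T \<inter> topspace (X s)))"
    show "S \<inter> T \<subseteq> (\<Union>s. topspace (X s))" using S by blast
    have "S \<inter> T \<inter> topspace (X s) = (S \<inter> topspace (X s)) \<inter> (T \<inter> topspace (X s))" by blast
    then show "openin (X s) (S \<inter> T \<inter> topspace (X s))" using S T by (metis openin_Int)
  next
    fix \<K> s
    assume K: "\<forall>K\<in>\<K>. K \<subseteq> (\<Union>s. topspace (X s)) \<and> (\<forall>s. openin (X s) (K \<inter> topspace (X s)))"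
    show "\<Union> \<K> \<subseteq> (\<Union>s. topspace (X s))" using K by blast
    have "\<Union> \<K> \<inter> topspace (X s) = (\<Union>K\<in>\<K>. K \<inter> topspace (X s))" by blast
    moreover have "openin (X s) (\<Union>K\<in>\<K>. K \<inter> topspace (X s))"
      using K by (intro openin_Union ballI) (metis (no_types, lifting) imageE)
    ultimately show "openin (X s) (\<Union> \<K> \<inter> topspace (X s))" by simp
  qed
  then show ?thesis unfolding direct_limit_topology_def by simp
qed

lemma openin_quotient_topology:
  "openin (quotient_topology X f S) U \<longleftrightarrow> U \<subseteq> S \<and> openin X {x \<in> topspace X. f x \<in> U}"
proof -
  have "istopology (\<lambda>U. U \<subseteq> S \<and> openin X {x \<in> topspace X. f x \<in> U})"
    unfolding istopology_def
  proof (intro conjI allI impI)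
    fix A B
    assume A: "A \<subseteq> S \<and> openin X {x \<in> topspace X. f x \<in> A}"
      and B: "B \<subseteq> S \<and> openin X {x \<in> topspace X. f x \<in> B}"
    show "A \<inter> B \<subseteq> S" using A by blast
    have "{x \<in> topspace X. f x \<in> A \<inter> B} = {x \<in> topspace X. f x \<in> A} \<inter> {x \<in> topspace X. f x \<in> B}"
      by blast
    moreover have "openin X ({x \<in> topspace X. f x \<in> A} \<inter> {x \<in> topspace X. f x \<in> B})"
      by (rule openin_Int) (simp_all only: A B)
    ultimately show "openin X {x \<in> topspace X. f x \<in> A \<inter> B}" by (simp only:)
  next
    fix \<K>
    assume K: "\<forall>K\<in>\<K>. K \<subseteq> S \<and> openin X {x \<in> topspace X. f x \<in> K}"
    show "\<Union> \<K> \<subseteq> S" using K by blast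
    have "{x \<in> topspace X. f x \<in> \<Union> \<K>} = (\<Union>K\<in>\<K>. {x \<in> topspace X. f x \<in> K})" by blast
    moreover have "openin X (\<Union>K\<in>\<K>. {x \<in> topspace X. f x \<in> K})"
      using K by (intro openin_Union ballI) (metis (no_types, lifting) imageE)
    ultimately show "openin X {x \<in> topspace X. f x \<in> \<Union> \<K>}" by simp
  qed
  then show ?thesis unfolding quotient_topology_def by simp
qed

lemma topspace_direct_limit_topology: "topspace (direct_limit_topology X) = (\<Union>s. topspace (X s))"
proof
  show "topspace (direct_limit_topology X) \<subseteq> (\<Union>s. topspace (X s))"
    using openin_topspace[of "direct_limit_topology X"] by (simp only: openin_direct_limit_topology)
  have "(\<Union>s. topspace (X s)) \<inter> topspace (X s) = topspace (X s)" for s by blast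
  then have "openin (direct_limit_topology X) (\<Union>s. topspace (X s))"
    unfolding openin_direct_limit_topology by simp
  then show "(\<Union>s. topspace (X s)) \<subseteq> topspace (direct_limit_topology X)"
    by (rule openin_subset)
qed

lemma topspace_quotient_topology:
  assumes "f ` topspace X \<subseteq> S"
  shows "topspace (quotient_topology X f S) = S"
proof
  show "topspace (quotient_topology X f S) \<subseteq> S"
    using openin_topspace[of "quotient_topology X f S"] by (simp only: openin_quotient_topology)
  have "{x \<in> topspace X. f x \<in> S} = topspace X" using assms by blast
  then have "openin (quotient_topology X f S) S"
    unfolding openin_quotient_topology by simp
  then show "S \<subseteq> topspace (quotient_topology X f S)" by (rule openin_subset)
qed


section \<open>Groups and group actions\<close>

definition cyclic_roots :: "nat \<Rightarrow> complex set" where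
  "cyclic_roots n = {\<gamma>. \<gamma> ^ n = 1}"

definition conj_transpose :: "complex ^ 'r ^ 'r \<Rightarrow> complex ^ 'r ^ 'r" where
  "conj_transpose a = (\<chi> i j. cnj (a $ j $ i))"

definition unitary_group :: "(complex ^ 'r ^ 'r) set" where
  "unitary_group = {a. a ** conj_transpose a = mat 1 \<and> conj_transpose a ** a = mat 1}"

text \<open>The group of roots of unity is finite and carries the discrete topology, so that
  continuity of an action is continuity of each of its maps.\<close>

definition cyclic_space :: "nat \<Rightarrow> 'a topology \<Rightarrow> (complex \<Rightarrow> 'a \<Rightarrow> 'a) \<Rightarrow> bool" where
  "cyclic_space n X act \<longleftrightarrow>
     (\<forall>\<gamma>\<in>cyclic_roots n. continuous_map X X (act \<gamma>)) \<and>
     (\<forall>x\<in>topspace X. act 1 x = x) \<and>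
     (\<forall>\<gamma>\<in>cyclic_roots n. \<forall>\<delta>\<in>cyclic_roots n. \<forall>x\<in>topspace X. act (\<gamma> * \<delta>) x = act \<gamma> (act \<delta> x))"


section \<open>Principal bundles\<close>

record ('p, 'b, 'r) principal_data =
  pb_total :: "'p topology"
  pb_base :: "'b topology"
  pb_proj :: "'p \<Rightarrow> 'b"
  pb_mult :: "'p \<Rightarrow> complex ^ 'r ^ 'r \<Rightarrow> 'p"
  pb_act :: "complex \<Rightarrow> 'p \<Rightarrow> 'p"
  pb_base_act :: "complex \<Rightarrow> 'b \<Rightarrow> 'b"

definition principal_unitary_bundle :: "('p, 'b, 'r::finite) principal_data \<Rightarrow> bool" where
  "principal_unitary_bundle P \<longleftrightarrow>
     continuous_map (pb_total P) (pb_base P) (pb_proj P) \<and>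
     continuous_map (prod_topology (pb_total P) (top_of_set unitary_group)) (pb_total P)
       (\<lambda>(p, a). pb_mult P p a) \<and>
     (\<forall>p\<in>topspace (pb_total P). pb_mult P p (mat 1) = p) \<and>
     (\<forall>p\<in>topspace (pb_total P). \<forall>a\<in>unitary_group. \<forall>b\<in>unitary_group.
        pb_mult P p (a ** b) = pb_mult P (pb_mult P p a) b) \<and>
     (\<forall>p\<in>topspace (pb_total P). \<forall>a\<in>unitary_group. pb_proj P (pb_mult P p a) = pb_proj P p) \<and>
     (\<forall>b\<in>topspace (pb_base P). \<exists>U \<phi>.
        openin (pb_base P) U \<and> b \<in> U \<and>
        homeomorphic_map (subtopology (pb_total P) {p \<in> topspace (pb_total P). pb_proj P p \<in> U})
          (prod_topology (subtopology (pb_base P) U) (top_of_set unitary_group)) \<phi> \<and>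
        (\<forall>p\<in>topspace (pb_total P). pb_proj P p \<in> U \<longrightarrow>
           fst (\<phi> p) = pb_proj P p \<and>
           (\<forall>a\<in>unitary_group. \<phi> (pb_mult P p a) = (pb_proj P p, snd (\<phi> p) ** a))))"

definition cyclic_principal_bundle :: "nat \<Rightarrow> ('p, 'b, 'r::finite) principal_data \<Rightarrow> bool" where
  "cyclic_principal_bundle n P \<longleftrightarrow>
     principal_unitary_bundle P \<and>
     cyclic_space n (pb_total P) (pb_act P) \<and>
     cyclic_space n (pb_base P) (pb_base_act P) \<and>
     (\<forall>\<gamma>\<in>cyclic_roots n. \<forall>p\<in>topspace (pb_total P).
        pb_proj P (pb_act P \<gamma> p) = pb_base_act P \<gamma> (pb_proj P p) \<and>
        (\<forall>a\<in>unitary_group. pb_act P \<gamma> (pb_mult P p a) = pb_mult P (pb_act P \<gamma> p) a))"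


section \<open>Vector bundles\<close>

text \<open>The addition of vectors is only meaningful for two points of the same fibre.\<close>

record ('e, 'b) vb_data =
  vb_total :: "'e topology"
  vb_base :: "'b topology"
  vb_proj :: "'e \<Rightarrow> 'b"
  vb_add :: "'e \<Rightarrow> 'e \<Rightarrow> 'e"
  vb_scale :: "complex \<Rightarrow> 'e \<Rightarrow> 'e"
  vb_act :: "complex \<Rightarrow> 'e \<Rightarrow> 'e"
  vb_base_act :: "complex \<Rightarrow> 'b \<Rightarrow> 'b"

definition vb_fibre :: "('e, 'b) vb_data \<Rightarrow> 'b \<Rightarrow> 'e set" where
  "vb_fibre E b = {x \<in> topspace (vb_total E). vb_proj E x = b}"

text \<open>The vector space laws on the fibres are not listed: they follow from closure under the
  operations and from the existence of fibrewise linear bijections onto \<open>complex ^ 'r\<close>.\<close>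

definition vector_bundle :: "'r::finite itself \<Rightarrow> ('e, 'b) vb_data \<Rightarrow> bool" where
  "vector_bundle (_ :: 'r itself) E \<longleftrightarrow>
     continuous_map (vb_total E) (vb_base E) (vb_proj E) \<and>
     (\<forall>b\<in>topspace (vb_base E).
        (\<forall>x\<in>vb_fibre E b. \<forall>y\<in>vb_fibre E b. vb_add E x y \<in> vb_fibre E b) \<and>
        (\<forall>c. \<forall>x\<in>vb_fibre E b. vb_scale E c x \<in> vb_fibre E b)) \<and>
     (\<forall>b\<in>topspace (vb_base E). \<exists>U (\<phi> :: 'e \<Rightarrow> 'b \<times> (complex ^ 'r)).
        openin (vb_base E) U \<and> b \<in> U \<and>
        homeomorphic_map (subtopology (vb_total E) {x \<in> topspace (vb_total E). vb_proj E x \<in> U})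
          (prod_topology (subtopology (vb_base E) U) euclidean) \<phi> \<and>
        (\<forall>u\<in>U. \<forall>x\<in>vb_fibre E u.
           fst (\<phi> x) = u \<and>
           (\<forall>y\<in>vb_fibre E u. snd (\<phi> (vb_add E x y)) = snd (\<phi> x) + snd (\<phi> y)) \<and>
           (\<forall>c. snd (\<phi> (vb_scale E c x)) = c *s snd (\<phi> x))))"

definition vb_linear_over ::
  "('b \<Rightarrow> 'b) \<Rightarrow> ('e, 'b) vb_data \<Rightarrow> ('f, 'b) vb_data \<Rightarrow> ('e \<Rightarrow> 'f) \<Rightarrow> bool" where
  "vb_linear_over g E F f \<longleftrightarrow>
     (\<forall>b\<in>topspace (vb_base E). \<forall>x\<in>vb_fibre E b.
        f x \<in> vb_fibre F (g b) \<and>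
        (\<forall>y\<in>vb_fibre E b. f (vb_add E x y) = vb_add F (f x) (f y)) \<and>
        (\<forall>c. f (vb_scale E c x) = vb_scale F c (f x)))"

definition cyclic_vector_bundle :: "nat \<Rightarrow> 'r::finite itself \<Rightarrow> ('e, 'b) vb_data \<Rightarrow> bool" where
  "cyclic_vector_bundle n R E \<longleftrightarrow>
     vector_bundle R E \<and>
     cyclic_space n (vb_total E) (vb_act E) \<and>
     cyclic_space n (vb_base E) (vb_base_act E) \<and>
     (\<forall>\<gamma>\<in>cyclic_roots n. vb_linear_over (vb_base_act E \<gamma>) E E (vb_act E \<gamma>))"

definition cyclic_vb_equivalent ::
  "nat \<Rightarrow> 'r::finite itself \<Rightarrow> ('e, 'b) vb_data \<Rightarrow> ('f, 'b) vb_data \<Rightarrow> bool" where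
  "cyclic_vb_equivalent n R E F \<longleftrightarrow>
     cyclic_vector_bundle n R E \<and> cyclic_vector_bundle n R F \<and>
     vb_base E = vb_base F \<and>
     (\<forall>\<gamma>\<in>cyclic_roots n. \<forall>b\<in>topspace (vb_base E). vb_base_act E \<gamma> b = vb_base_act F \<gamma> b) \<and>
     (\<exists>f. homeomorphic_map (vb_total E) (vb_total F) f \<and>
        vb_linear_over id E F f \<and>
        (\<forall>\<gamma>\<in>cyclic_roots n. \<forall>x\<in>topspace (vb_total E). f (vb_act E \<gamma> x) = vb_act F \<gamma> (f x)))"


section \<open>The vector bundle associated with a principal bundle\<close>

text \<open>For a right action this is already an equivalence relation on \<open>P \<times> complex ^ 'r\<close>.\<close>

definition assoc_rel ::
  "('p, 'b, 'r::finite) principal_data \<Rightarrow> (('p \<times> (complex ^ 'r)) \<times> ('p \<times> (complex ^ 'r))) set" where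
  "assoc_rel P = {((pb_mult P v a, y), (v, a *v y)) | v a y.
     v \<in> topspace (pb_total P) \<and> a \<in> unitary_group}"

text \<open>The operations are carried out on representatives. In a principal bundle, the first
  components of the pairs in a class run exactly once through a fibre of \<open>P\<close>; hence the sum of two
  classes over the same base point is a class, and so are multiples and translates.\<close>

definition associated_bundle ::
  "('p, 'b, 'r::finite) principal_data \<Rightarrow> (('p \<times> (complex ^ 'r)) set, 'b) vb_data" where
  "associated_bundle P =
    \<lparr> vb_total = quotient_topology (prod_topology (pb_total P) euclidean)
        (\<lambda>x. assoc_rel P `` {x}) ((topspace (pb_total P) \<times> UNIV) // assoc_rel P),
      vb_base = pb_base P,
      vb_proj = (\<lambda>C. the_elem ((\<lambda>(v, y). pb_proj P v) ` C)),
      vb_add = (\<lambda>C D. {(v, y + y') | v y y'. (v, y) \<in> C \<and> (v, y') \<in> D}),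
      vb_scale = (\<lambda>c C. {(v, c *s y) | v y. (v, y) \<in> C}),
      vb_act = (\<lambda>\<gamma> C. {(pb_act P \<gamma> v, y) | v y. (v, y) \<in> C}),
      vb_base_act = pb_base_act P \<rparr>"


section \<open>The space \<open>\<complex>\<^sup>\<infinity>\<close>, frames and subspaces\<close>

text \<open>Vectors are sequences whose coordinates are counted from \<open>0\<close>; the coordinate \<open>z k\<close> is the
  \<open>(k + 1)\<close>-st one, which explains the exponent \<open>k + 1\<close> in the actions below.\<close>

definition coord_space :: "nat \<Rightarrow> (nat \<Rightarrow> complex) set" where
  "coord_space s = {z. \<forall>k\<ge>s. z k = 0}"

definition C_infinity :: "(nat \<Rightarrow> complex) topology" where
  "C_infinity = direct_limit_topology (\<lambda>s. top_of_set (coord_space s))"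

definition cscale :: "complex \<Rightarrow> (nat \<Rightarrow> complex) \<Rightarrow> (nat \<Rightarrow> complex)" where
  "cscale c z = (\<lambda>k. c * z k)"

interpretation cseq: vector_space cscale
  by unfold_locales (simp_all add: cscale_def fun_eq_iff distrib_left distrib_right mult.assoc)

definition module_act :: "complex \<Rightarrow> (nat \<Rightarrow> complex) \<Rightarrow> (nat \<Rightarrow> complex)" where
  "module_act \<gamma> z = (\<lambda>k. \<gamma> ^ (k + 1) * z k)"

definition frames :: "nat \<Rightarrow> ((nat \<Rightarrow> complex) ^ 'r) set" where
  "frames s = {v. (\<forall>i. v $ i \<in> coord_space s) \<and>
     (\<forall>i j. (\<Sum>k<s. (v $ i) k * cnj ((v $ j) k)) = (if i = j then 1 else 0))}"

definition stiefel :: "((nat \<Rightarrow> complex) ^ 'r) topology" where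
  "stiefel = direct_limit_topology (\<lambda>s. top_of_set (frames s))"

definition stiefel_act ::
  "complex \<Rightarrow> complex ^ 'r ^ 'r \<Rightarrow> (nat \<Rightarrow> complex) ^ 'r \<Rightarrow> (nat \<Rightarrow> complex) ^ 'r::finite" where
  "stiefel_act \<gamma> a v = (\<chi> j. (\<lambda>k. \<gamma> ^ (k + 1) * (\<Sum>i\<in>UNIV. cnj (a $ j $ i) * (v $ i) k)))"

definition frame_span :: "(nat \<Rightarrow> complex) ^ 'r \<Rightarrow> (nat \<Rightarrow> complex) set" where
  "frame_span v = cseq.span (range (\<lambda>i. v $ i))"

definition grassmannian_set :: "'r::finite itself \<Rightarrow> (nat \<Rightarrow> complex) set set" where
  "grassmannian_set (_ :: 'r itself) =
     {N. cseq.subspace N \<and> N \<subseteq> topspace C_infinity \<and> cseq.dim N = CARD('r)}"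

definition grassmannian :: "'r::finite itself \<Rightarrow> (nat \<Rightarrow> complex) set topology" where
  "grassmannian (R :: 'r itself) =
     quotient_topology (stiefel :: ((nat \<Rightarrow> complex) ^ 'r) topology) frame_span (grassmannian_set R)"

definition stiefel_bundle ::
  "((nat \<Rightarrow> complex) ^ 'r, (nat \<Rightarrow> complex) set, 'r::finite) principal_data" where
  "stiefel_bundle =
    \<lparr> pb_total = stiefel,
      pb_base = grassmannian TYPE('r),
      pb_proj = frame_span,
      pb_mult = (\<lambda>v a. stiefel_act 1 (matrix_inv a) v),
      pb_act = (\<lambda>\<gamma>. stiefel_act \<gamma> (mat 1)),
      pb_base_act = (\<lambda>\<gamma> N. module_act \<gamma> ` N) \<rparr>"

definition canonical_bundle ::
  "'r::finite itself \<Rightarrow> ((nat \<Rightarrow> complex) set \<times> (nat \<Rightarrow> complex), (nat \<Rightarrow> complex) set) vb_data" where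
  "canonical_bundle R =
    \<lparr> vb_total = subtopology (prod_topology (grassmannian R) C_infinity) {(N, z). z \<in> N},
      vb_base = grassmannian R,
      vb_proj = fst,
      vb_add = (\<lambda>(N, z) (N', z'). (N, z + z')),
      vb_scale = (\<lambda>c (N, z). (N, cscale c z)),
      vb_act = (\<lambda>\<gamma> (N, z). (module_act \<gamma> ` N, module_act \<gamma> z)),
      vb_base_act = (\<lambda>\<gamma> N. module_act \<gamma> ` N) \<rparr>"

end

theory Submission
  imports Defs
begin

text \<open>Write \<open>V\<close> for the Stiefel space, \<open>G\<close> for the Grassmannian and \<open>E\<close> for the total space of the
  canonical bundle. The map \<open>(v, y) \<mapsto> (span v, \<Sum>i. y\<^sub>i v\<^sub>i)\<close> from \<open>V \<times> \<complex>\<^sup>r\<close> to \<open>E\<close> is a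
  quotient map whose fibres are exactly the classes of the associated bundle; this gives the
  equivalence. It is open because \<open>V \<rightarrow> G\<close> is the orbit map of a group action, and the coordinates
  of a vector in a frame are inner products, which are jointly continuous. Local triviality comes
  from local sections of \<open>V \<rightarrow> G\<close>: project a fixed frame to the given subspace and
  orthonormalise.\<close>

section \<open>Frames and inner products of finitely supported sequences\<close>

text \<open>Two obstacles shape the argument. The first is topological: products do not commute with
  direct limits in general. For \<open>\<complex>^r\<close> and the unitary group as second factor,
  local compactness allows continuity to be checked stage by stage. \<open>C_infinity\<close> is not
  locally compact, so inner products need a norm estimate, and the passage from frames to subspaces
  with a vector carried along uses openness of \<open>frame_span\<close>, since a product of a
  quotient map with an identity need not be a quotient map. The second is that a section must not
  depend on the frame that represents a subspace. If \<open>A\<close> is the matrix of inner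
  products of a frame \<open>v\<close> with the fixed frame, then \<open>v a\<close> has the matrix
  \<open>A ** a\<close>. A map \<open>q\<close> into the unitary group with
  \<open>q (A ** a) = q A ** a\<close> therefore makes
  \<open>frame_mult v (conj_transpose (q A))\<close> constant on orbits. Charts and linearity are
  established for the canonical bundle only. The associated bundle, whose points are sets of pairs,
  receives them through the homeomorphism.\<close>

definition finseq :: "(nat \<Rightarrow> complex) set" where
  "finseq = (\<Union>s. coord_space s)"

text \<open>Summing over the support of \<open>x\<close> avoids mentioning a stage; for
  \<open>x\<close> in \<open>coord_space s\<close> this is the sum below \<open>s\<close>, whatever
  \<open>y\<close> is.\<close>

definition herm :: "(nat \<Rightarrow> complex) \<Rightarrow> (nat \<Rightarrow> complex) \<Rightarrow> complex" where
  "herm x y = (\<Sum>k | x k \<noteq> 0. x k * cnj (y k))"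

lemma topspace_C_infinity: "topspace C_infinity = finseq"
  by (simp add: C_infinity_def topspace_direct_limit_topology finseq_def)

lemma coord_space_mono: "s \<le> t \<Longrightarrow> coord_space s \<subseteq> coord_space t"
  by (auto simp: coord_space_def)

lemma subspace_coord_space: "cseq.subspace (coord_space s)"
  by (auto simp: cseq.subspace_def coord_space_def cscale_def)

lemma finseq_common_bound:
  assumes "finite I" "\<And>i. i \<in> I \<Longrightarrow> f i \<in> finseq"
  obtains s where "\<And>i. i \<in> I \<Longrightarrow> f i \<in> coord_space s"
proof -
  have "\<forall>i\<in>I. \<exists>s. f i \<in> coord_space s"
    using assms(2) by (auto simp: finseq_def)
  from bchoice[OF this] obtain t where t: "\<forall>i\<in>I. f i \<in> coord_space (t i)" ..
  \<comment> \<open>The sum of the bounds replaces their maximum, which would require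
    \<open>I\<close> to be nonempty.\<close>
  have "f i \<in> coord_space (\<Sum>j\<in>I. t j)" if "i \<in> I" for i
  proof -
    have "t i \<le> (\<Sum>j\<in>I. t j)" using that assms(1) by (simp add: member_le_sum)
    from coord_space_mono[OF this] show ?thesis using t that by auto
  qed
  then show ?thesis using that by blast
qed

lemma finseq_common_bound2:
  assumes "x \<in> finseq" "y \<in> finseq"
  obtains s where "x \<in> coord_space s" "y \<in> coord_space s"
proof -
  obtain s where "\<And>z. z \<in> {x, y} \<Longrightarrow> id z \<in> coord_space s"
    by (rule finseq_common_bound[of "{x, y}" id]) (use assms in auto)
  then show ?thesis using that[of s] by simp
qed

lemma subspace_finseq: "cseq.subspace finseq"
  unfolding cseq.subspace_def
proof (intro conjI ballI allI)
  show "0 \<in> finseq"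
    using subspace_coord_space[of 0] by (auto simp: finseq_def cseq.subspace_def)
  show "x + y \<in> finseq" if "x \<in> finseq" "y \<in> finseq" for x y
    by (rule finseq_common_bound2[OF that])
      (use subspace_coord_space in \<open>auto simp: finseq_def cseq.subspace_def\<close>)
  show "cscale c x \<in> finseq" if "x \<in> finseq" for c x
    using that by (auto simp: finseq_def coord_space_def cscale_def)
qed

lemma herm_eq_sum:
  assumes "x \<in> coord_space s"
  shows "herm x y = (\<Sum>k<s. x k * cnj (y k))"
proof -
  have "{k. x k \<noteq> 0} \<subseteq> {..<s}"
    using assms by (force simp: coord_space_def not_le)
  then show ?thesis
    unfolding herm_def by (intro sum.mono_neutral_left) auto
qed

lemma herm_add_left:
  assumes "x \<in> finseq" "y \<in> finseq"
  shows "herm (x + y) z = herm x z + herm y z"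
proof -
  obtain s where s: "x \<in> coord_space s" "y \<in> coord_space s"
    using finseq_common_bound2 assms by blast
  then have "x + y \<in> coord_space s"
    using subspace_coord_space by (auto simp: cseq.subspace_def)
  with s show ?thesis by (simp add: herm_eq_sum distrib_right sum.distrib)
qed

lemma herm_cscale_left:
  assumes "x \<in> finseq"
  shows "herm (cscale c x) z = c * herm x z"
proof -
  obtain s where s: "x \<in> coord_space s"
    using assms by (auto simp: finseq_def)
  then have "cscale c x \<in> coord_space s"
    using subspace_coord_space by (auto simp: cseq.subspace_def)
  with s show ?thesis by (simp add: herm_eq_sum cscale_def sum_distrib_left mult.assoc)
qed

lemma herm_commute:
  assumes "x \<in> finseq" "y \<in> finseq"
  shows "herm y x = cnj (herm x y)"
proof -
  obtain s where "x \<in> coord_space s" "y \<in> coord_space s"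
    using finseq_common_bound2 assms by blast
  then show ?thesis by (simp add: herm_eq_sum mult.commute)
qed

lemma herm_cscale_right:
  assumes "x \<in> finseq" "z \<in> finseq"
  shows "herm z (cscale c x) = cnj c * herm z x"
  using assms subspace_finseq
  by (simp add: herm_cscale_left herm_commute[of _ z] cseq.subspace_def)

lemma herm_self:
  assumes "x \<in> coord_space s"
  shows "herm x x = of_real (\<Sum>k<s. (cmod (x k))\<^sup>2)"
  by (simp add: herm_eq_sum[OF assms] flip: complex_norm_square)

lemma herm_self_real: "x \<in> finseq \<Longrightarrow> herm x x = of_real (Re (herm x x))"
  by (auto simp: finseq_def herm_self)

lemma herm_self_pos:
  assumes "x \<in> finseq" "x \<noteq> 0"
  shows "Re (herm x x) > 0"
proof -
  obtain s where s: "x \<in> coord_space s"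
    using assms by (auto simp: finseq_def)
  obtain k where k: "x k \<noteq> 0" using assms by (auto simp: fun_eq_iff)
  with s have "k < s" by (force simp: coord_space_def not_le)
  then have "(\<Sum>k<s. (cmod (x k))\<^sup>2) > 0"
    using k by (intro sum_pos2[of _ k]) auto
  then show ?thesis by (simp add: herm_self[OF s])
qed

lemma herm_sum_left:
  assumes "finite I" "\<And>i. i \<in> I \<Longrightarrow> f i \<in> finseq"
  shows "herm (\<Sum>i\<in>I. f i) z = (\<Sum>i\<in>I. herm (f i) z)"
  using assms
proof (induction I rule: finite_induct)
  case empty
  then show ?case by (simp add: herm_def)
next
  case (insert i I)
  then have "(\<Sum>i\<in>I. f i) \<in> finseq"
    using cseq.subspace_sum[OF subspace_finseq] by blast
  with insert have "herm (f i + (\<Sum>i\<in>I. f i)) z = herm (f i) z + (\<Sum>i\<in>I. herm (f i) z)"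
    by (subst herm_add_left) auto
  then show ?case by (simp only: sum.insert[OF insert(1,2)])
qed

definition frame_comb :: "(nat \<Rightarrow> complex) ^ 'r \<Rightarrow> complex ^ 'r \<Rightarrow> nat \<Rightarrow> complex" where
  "frame_comb v y = (\<Sum>i\<in>UNIV. cscale (y $ i) (v $ i))"

text \<open>For an orthonormal \<open>v\<close> and a vector \<open>z\<close> outside its span,
  these are the coordinates of the orthogonal projection of \<open>z\<close>.\<close>

definition frame_coords :: "(nat \<Rightarrow> complex) ^ 'r \<Rightarrow> (nat \<Rightarrow> complex) \<Rightarrow> complex ^ 'r" where
  "frame_coords v z = (\<chi> i. herm z (v $ i))"

text \<open>The right action written without an inverse and for arbitrary matrices; for unitary
  \<open>a\<close> it agrees with \<open>pb_mult\<close> of the Stiefel bundle, see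
  \<open>stiefel_act_inv\<close>.\<close>

definition frame_mult :: "(nat \<Rightarrow> complex) ^ 'r \<Rightarrow> complex ^ 'r ^ 'r \<Rightarrow> (nat \<Rightarrow> complex) ^ 'r" where
  "frame_mult v a = (\<chi> j. frame_comb v (column j a))"

text \<open>Column \<open>j\<close> holds the inner products of \<open>w $ j\<close> with the
  members of \<open>v\<close>. For orthonormal frames of one subspace this is the transition matrix;
  in general it is the matrix of the orthogonal projection from the span of \<open>w\<close> to that
  of \<open>v\<close>.\<close>

definition frame_change :: "(nat \<Rightarrow> complex) ^ 'r \<Rightarrow> (nat \<Rightarrow> complex) ^ 'r \<Rightarrow> complex ^ 'r ^ 'r" where
  "frame_change v w = (\<chi> i j. herm (w $ j) (v $ i))"

abbreviation stiefel_set :: "((nat \<Rightarrow> complex) ^ 'r) set" where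
  "stiefel_set \<equiv> topspace stiefel"

lemma sum_fun_apply: "(\<Sum>i\<in>I. f i) k = (\<Sum>i\<in>I. f i k)"
  by (induction I rule: infinite_finite_induct) auto

lemma frame_comb_apply: "frame_comb v y k = (\<Sum>i\<in>UNIV. y $ i * (v $ i) k)"
  by (simp add: frame_comb_def sum_fun_apply cscale_def)

text \<open>The finitely many members of a frame lie in a common stage, where the truncated sums in
  \<open>frames\<close> are values of \<open>herm\<close>. From here on stages occur only in
  continuity proofs.\<close>

lemma topspace_stiefel:
  "(stiefel_set :: ((nat \<Rightarrow> complex) ^ 'r) set) =
    {v. (\<forall>i. v $ i \<in> finseq) \<and> (\<forall>i j. herm (v $ i) (v $ j) = (if i = j then 1 else 0))}"
proof -
  have "v \<in> stiefel_set \<longleftrightarrow>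
      (\<forall>i. v $ i \<in> finseq) \<and> (\<forall>i j. herm (v $ i) (v $ j) = (if i = j then 1 else 0))"
    for v :: "(nat \<Rightarrow> complex) ^ 'r"
  proof
    assume "v \<in> stiefel_set"
    then obtain s where "v \<in> frames s"
      by (auto simp: stiefel_def topspace_direct_limit_topology)
    then show "(\<forall>i. v $ i \<in> finseq) \<and> (\<forall>i j. herm (v $ i) (v $ j) = (if i = j then 1 else 0))"
      unfolding frames_def finseq_def by (auto simp: herm_eq_sum[of _ s])
  next
    assume v: "(\<forall>i. v $ i \<in> finseq) \<and> (\<forall>i j. herm (v $ i) (v $ j) = (if i = j then 1 else 0))"
    obtain s where s: "\<And>i. v $ i \<in> coord_space s"
      using finseq_common_bound[of UNIV "\<lambda>i. v $ i"] v by auto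
    then have "v \<in> frames s" using v by (simp add: frames_def flip: herm_eq_sum[OF s])
    then show "v \<in> stiefel_set"
      by (auto simp: stiefel_def topspace_direct_limit_topology)
  qed
  then show ?thesis by blast
qed

lemma frame_comb_in_subspace:
  assumes "cseq.subspace N" "\<And>i. v $ i \<in> N"
  shows "frame_comb v y \<in> N"
  unfolding frame_comb_def
  by (intro cseq.subspace_sum cseq.subspace_scale) (use assms in auto)

lemma frame_comb_in_finseq: "v \<in> stiefel_set \<Longrightarrow> frame_comb v y \<in> finseq"
  by (rule frame_comb_in_subspace[OF subspace_finseq]) (auto simp: topspace_stiefel)

lemma frame_comb_add: "frame_comb v (y + y') = frame_comb v y + frame_comb v y'"
  by (simp add: fun_eq_iff frame_comb_apply distrib_right sum.distrib)

lemma frame_comb_scale: "frame_comb v (c *s y) = cscale c (frame_comb v y)"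
  by (simp add: fun_eq_iff frame_comb_apply cscale_def sum_distrib_left mult.assoc)

lemma frame_comb_axis: "frame_comb v (axis i 1) = v $ i"
  by (simp add: fun_eq_iff frame_comb_apply axis_def if_distrib[of "\<lambda>c. c * _"] cong: if_cong)

text \<open>The identity behind the associated bundle: the pairs \<open>(v a, y)\<close> and
  \<open>(v, a *v y)\<close>, which \<open>assoc_rel\<close> identifies, represent the same
  vector.\<close>

lemma frame_comb_mult: "frame_comb (frame_mult v a) y = frame_comb v (a *v y)"
proof
  fix k
  have "frame_comb (frame_mult v a) y k = (\<Sum>j\<in>UNIV. \<Sum>i\<in>UNIV. y $ j * (a $ i $ j * (v $ i) k))"
    by (simp add: frame_comb_apply frame_mult_def column_def sum_distrib_left)
  also have "\<dots> = (\<Sum>i\<in>UNIV. \<Sum>j\<in>UNIV. y $ j * (a $ i $ j * (v $ i) k))"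
    by (rule sum.swap)
  also have "\<dots> = frame_comb v (a *v y) k"
    by (simp add: frame_comb_apply matrix_vector_mult_def sum_distrib_left mult_ac)
  finally show "frame_comb (frame_mult v a) y k = frame_comb v (a *v y) k" .
qed

lemma frame_span_eq_range:
  fixes v :: "(nat \<Rightarrow> complex) ^ 'r"
  shows "frame_span v = range (frame_comb v)"
proof
  show "frame_span v \<subseteq> range (frame_comb v)"
    unfolding frame_span_def
  proof (rule cseq.span_minimal)
    show "range (\<lambda>i. v $ i) \<subseteq> range (frame_comb v)"
      using frame_comb_axis[of v] by (metis image_subsetI rangeI)
    have "frame_comb v 0 = 0" by (simp add: fun_eq_iff frame_comb_apply)
    then show "cseq.subspace (range (frame_comb v))"
      unfolding cseq.subspace_def
      by (auto simp flip: frame_comb_add frame_comb_scale)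
  qed
  show "range (frame_comb v) \<subseteq> frame_span v"
    using frame_comb_in_subspace[OF cseq.subspace_span, of v "range (\<lambda>i. v $ i)"]
    by (auto simp: frame_span_def cseq.span_base)
qed

lemma frame_comb_in_span: "frame_comb v y \<in> frame_span v"
  by (simp add: frame_span_eq_range)

lemma frame_in_span: "v $ i \<in> frame_span v"
  unfolding frame_span_def by (simp add: cseq.span_base)

lemma subspace_frame_span: "cseq.subspace (frame_span v)"
  unfolding frame_span_def by simp

lemma herm_frame_comb_left:
  assumes "v \<in> stiefel_set"
  shows "herm (frame_comb v y) z = (\<Sum>i\<in>UNIV. y $ i * herm (v $ i) z)"
proof -
  have v: "v $ i \<in> finseq" for i using assms by (auto simp: topspace_stiefel)
  then have "cscale c (v $ i) \<in> finseq" for c i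
    using subspace_finseq by (simp add: cseq.subspace_def)
  then show ?thesis
    unfolding frame_comb_def by (subst herm_sum_left) (simp_all add: herm_cscale_left v)
qed

lemma frame_coords_comb:
  assumes "v \<in> stiefel_set"
  shows "frame_coords v (frame_comb v y) = y"
proof -
  have "herm (v $ i) (v $ j) = (if i = j then 1 else 0)" for i j
    using assms by (simp add: topspace_stiefel)
  then show ?thesis
    by (simp add: vec_eq_iff frame_coords_def herm_frame_comb_left[OF assms]
        if_distrib[of "\<lambda>c. _ * c"] cong: if_cong)
qed

lemma frame_comb_coords:
  assumes "v \<in> stiefel_set" "z \<in> frame_span v"
  shows "frame_comb v (frame_coords v z) = z"
  using assms by (auto simp: frame_span_eq_range frame_coords_comb)

text \<open>A frame embeds \<open>\<complex>^r\<close> isometrically, which translates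
  orthonormality of frames into unitarity of matrices and back.\<close>

lemma herm_frame_comb:
  assumes "v \<in> stiefel_set"
  shows "herm (frame_comb v x) (frame_comb v y) = (\<Sum>i\<in>UNIV. x $ i * cnj (y $ i))"
proof -
  have "herm (v $ i) (frame_comb v y) = cnj (y $ i)" for i
    using arg_cong[OF frame_coords_comb[OF assms, of y], of "\<lambda>x. cnj (x $ i)"]
      herm_commute[of "frame_comb v y" "v $ i"] frame_comb_in_finseq[OF assms] assms
    by (simp add: frame_coords_def topspace_stiefel)
  then show ?thesis by (simp add: herm_frame_comb_left[OF assms])
qed

section \<open>Unitary matrices and their action on frames\<close>

lemma unitary_columns:
  assumes "a \<in> unitary_group"
  shows "(\<Sum>k\<in>UNIV. a $ k $ i * cnj (a $ k $ j)) = (if i = j then 1 else 0)"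
proof -
  have "(conj_transpose a ** a) $ j $ i = mat 1 $ j $ i"
    using assms by (simp add: unitary_group_def)
  then show ?thesis
    by (simp add: matrix_matrix_mult_def conj_transpose_def mat_def mult.commute eq_commute)
qed

text \<open>The assumption gives a left inverse, and for square matrices a left inverse is also a
  right inverse.\<close>

lemma unitary_groupI_columns:
  assumes "\<And>i j. (\<Sum>k\<in>UNIV. a $ k $ i * cnj (a $ k $ j)) = (if i = j then 1 else 0)"
  shows "a \<in> unitary_group"
proof -
  have "conj_transpose a ** a = mat 1"
    using assms by (simp add: vec_eq_iff matrix_matrix_mult_def conj_transpose_def mat_def
        mult.commute[of "cnj _"] eq_commute[of "_ :: 'a"])
  then show ?thesis
    using matrix_left_right_inverse by (auto simp: unitary_group_def)
qed

lemma unitary_groupI_rows: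
  assumes "\<And>i j. (\<Sum>k\<in>UNIV. a $ i $ k * cnj (a $ j $ k)) = (if i = j then 1 else 0)"
  shows "a \<in> unitary_group"
proof -
  have "a ** conj_transpose a = mat 1"
    using assms by (simp add: vec_eq_iff matrix_matrix_mult_def conj_transpose_def mat_def)
  then show ?thesis
    using matrix_left_right_inverse by (auto simp: unitary_group_def)
qed

lemma mat_1_unitary: "mat 1 \<in> unitary_group"
proof -
  have "conj_transpose (mat 1) = mat 1"
    by (simp add: vec_eq_iff conj_transpose_def mat_def)
  then show ?thesis by (simp add: unitary_group_def)
qed

lemma conj_transpose_conj_transpose [simp]: "conj_transpose (conj_transpose a) = a"
  by (simp add: conj_transpose_def vec_eq_iff)

lemma conj_transpose_unitary: "a \<in> unitary_group \<Longrightarrow> conj_transpose a \<in> unitary_group"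
  by (simp add: unitary_group_def)

text \<open>\<open>matrix_inv\<close> is a choice among two-sided inverses; uniqueness of the
  inverse determines the choice.\<close>

lemma matrix_inv_eq:
  fixes a :: "'a::semiring_1 ^ 'n ^ 'n"
  assumes "a ** b = mat 1" "b ** a = mat 1"
  shows "matrix_inv a = b"
  unfolding matrix_inv_def
proof (rule some_equality)
  fix c assume "a ** c = mat 1 \<and> c ** a = mat 1"
  then have "c = c ** (a ** b)" "(c ** a) ** b = b" by (simp_all add: assms)
  then show "c = b" by (simp add: matrix_mul_assoc)
qed (use assms in auto)

lemma matrix_inv_unitary: "a \<in> unitary_group \<Longrightarrow> matrix_inv a = conj_transpose a"
  by (rule matrix_inv_eq) (auto simp: unitary_group_def)

text \<open>The conjugation built into the left action cancels the one in the adjoint, so inverting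
  a unitary matrix turns the left action into plain right multiplication.\<close>

lemma stiefel_act_1: "stiefel_act 1 (conj_transpose a) v = frame_mult v a"
  by (simp add: stiefel_act_def frame_mult_def conj_transpose_def vec_eq_iff fun_eq_iff
      frame_comb_apply column_def)

lemma stiefel_act_inv: "a \<in> unitary_group \<Longrightarrow> stiefel_act 1 (matrix_inv a) v = frame_mult v a"
  by (simp add: matrix_inv_unitary stiefel_act_1)

lemma stiefel_act_mat_1: "stiefel_act \<gamma> (mat 1) v = (\<chi> j. module_act \<gamma> (v $ j))"
proof -
  have "(\<Sum>i\<in>UNIV. cnj (mat 1 $ j $ i) * (v $ i) k) = (\<Sum>i\<in>UNIV. if i = j then (v $ i) k else 0)" for j k
    by (rule sum.cong) (auto simp: mat_def)
  then show ?thesis by (simp add: stiefel_act_def module_act_def)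
qed

lemma frame_mult_1:
  fixes v :: "(nat \<Rightarrow> complex) ^ 'r"
  shows "frame_mult v (mat 1) = v"
proof -
  have "column j (mat 1 :: complex ^ 'r ^ 'r) = axis j 1" for j
    by (simp add: column_def mat_def axis_def vec_eq_iff)
  then show ?thesis by (simp add: frame_mult_def frame_comb_axis)
qed

lemma column_mult: "column j (a ** b) = a *v column j b"
  by (simp add: column_def matrix_matrix_mult_def matrix_vector_mult_def vec_eq_iff)

lemma frame_mult_mult: "frame_mult v (a ** b) = frame_mult (frame_mult v a) b"
proof -
  have "frame_comb v (column j (a ** b)) = frame_comb (frame_mult v a) (column j b)" for j
    by (simp add: column_mult frame_comb_mult)
  then show ?thesis by (simp add: frame_mult_def vec_eq_iff)
qed

lemma frame_mult_in_stiefel: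
  assumes "v \<in> stiefel_set" "a \<in> unitary_group"
  shows "frame_mult v a \<in> stiefel_set"
proof -
  have "(frame_mult v a) $ i \<in> finseq" for i
    by (simp add: frame_mult_def frame_comb_in_finseq assms(1))
  moreover have "herm ((frame_mult v a) $ i) ((frame_mult v a) $ j) = (if i = j then 1 else 0)" for i j
    by (simp add: frame_mult_def herm_frame_comb[OF assms(1)] column_def unitary_columns[OF assms(2)])
  ultimately show ?thesis unfolding topspace_stiefel by blast
qed

lemma frame_span_mult:
  fixes v :: "(nat \<Rightarrow> complex) ^ 'r"
  assumes "a \<in> unitary_group"
  shows "frame_span (frame_mult v a) = frame_span v"
proof
  \<comment> \<open>This inclusion holds for every matrix; the reverse one is its instance at the
    adjoint, which undoes \<open>a\<close>.\<close>
  show "frame_span (frame_mult v a) \<subseteq> frame_span v" for v :: "(nat \<Rightarrow> complex) ^ 'r" and a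
    by (auto simp: frame_span_eq_range frame_comb_mult)
  from this[of "frame_mult v a" "conj_transpose a"] assms
  show "frame_span v \<subseteq> frame_span (frame_mult v a)"
    by (simp add: frame_mult_1 unitary_group_def flip: frame_mult_mult)
qed

lemma frame_mult_change:
  assumes "v \<in> stiefel_set" "\<And>i. w $ i \<in> frame_span v"
  shows "frame_mult v (frame_change v w) = w"
proof -
  have "column j (frame_change v w) = frame_coords v (w $ j)" for j
    by (simp add: frame_change_def frame_coords_def column_def)
  then show ?thesis using assms by (simp add: frame_mult_def frame_comb_coords)
qed

text \<open>\<open>w\<close> stands in the linear argument of \<open>herm\<close>. The spans of
  \<open>v\<close> and \<open>w\<close> may differ, as they do when \<open>v\<close> is the fixed
  frame used for a local section.\<close>

lemma frame_change_mult_right: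
  assumes "w \<in> stiefel_set"
  shows "frame_change v (frame_mult w a) = frame_change v w ** a"
  by (simp add: vec_eq_iff frame_change_def frame_mult_def herm_frame_comb_left[OF assms]
      matrix_matrix_mult_def column_def mult.commute)

lemma frame_change_self: "v \<in> stiefel_set \<Longrightarrow> frame_change v v = mat 1"
  by (simp add: frame_change_def topspace_stiefel mat_def vec_eq_iff)

lemma frame_change_mult: "v \<in> stiefel_set \<Longrightarrow> frame_change v (frame_mult v a) = a"
  by (simp add: frame_change_mult_right frame_change_self)

text \<open>The columns are the coordinates of the orthonormal vectors \<open>w $ j\<close> in
  \<open>v\<close>, and taking coordinates preserves inner products.\<close>

lemma frame_change_unitary:
  assumes "v \<in> stiefel_set" "w \<in> stiefel_set" "frame_span v = frame_span w"
  shows "frame_change v w \<in> unitary_group"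
proof (rule unitary_groupI_columns)
  fix i j
  let ?c = "\<lambda>j. frame_coords v (w $ j)"
  have "herm (frame_comb v (?c i)) (frame_comb v (?c j)) = herm (w $ i) (w $ j)"
    using assms frame_in_span[of w] by (simp add: frame_comb_coords)
  then show "(\<Sum>k\<in>UNIV. frame_change v w $ k $ i * cnj (frame_change v w $ k $ j)) = (if i = j then 1 else 0)"
    using assms(2)
    by (simp add: herm_frame_comb[OF assms(1)] topspace_stiefel frame_coords_def frame_change_def)
qed

section \<open>Continuity for direct limit topologies\<close>

lemma continuous_map_direct_limit:
  "continuous_map (direct_limit_topology X) Z f \<longleftrightarrow> (\<forall>s. continuous_map (X s) Z f)"
proof -
  have "{x \<in> \<Union>s. topspace (X s). f x \<in> U} \<inter> topspace (X s) = {x \<in> topspace (X s). f x \<in> U}" for U s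
    by blast
  then show ?thesis
    by (auto simp: continuous_map_def openin_direct_limit_topology topspace_direct_limit_topology)
qed

lemma continuous_map_into_direct_limit:
  assumes "continuous_map Z (X s) f"
  shows "continuous_map Z (direct_limit_topology X) f"
proof -
  have "continuous_map (X s) (direct_limit_topology X) id"
    using continuous_map_direct_limit[of X "direct_limit_topology X" id] by simp
  from continuous_map_compose[OF assms this] show ?thesis by (simp add: o_def id_def)
qed

lemma quotient_map_sum_direct_limit:
  "quotient_map (sum_topology X UNIV) (direct_limit_topology X) snd"
  unfolding quotient_map_def
proof (intro conjI allI impI)
  show "snd ` topspace (sum_topology X UNIV) = topspace (direct_limit_topology X)"
    by (force simp: topspace_direct_limit_topology)
  fix U assume "U \<subseteq> topspace (direct_limit_topology X)"
  moreover have "{x. (s, x) \<in> topspace (sum_topology X UNIV) \<and> x \<in> U} = U \<inter> topspace (X s)" for s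
    by auto
  ultimately show "openin (sum_topology X UNIV) {x. x \<in> topspace (sum_topology X UNIV) \<and> snd x \<in> U}
      \<longleftrightarrow> openin (direct_limit_topology X) U"
    by (auto simp: openin_sum_topology openin_direct_limit_topology topspace_direct_limit_topology)
qed

text \<open>Each summand is open in the disjoint sum, so a neighbourhood found in the product of one
  summand with \<open>K\<close> is already a neighbourhood in the whole product.\<close>

lemma continuous_map_prod_sum_topology:
  assumes "\<And>s. continuous_map (prod_topology (X s) K) Z f"
  shows "continuous_map (prod_topology (sum_topology X UNIV) K) Z (f \<circ> (\<lambda>(x, y). (snd x, y)))"
  unfolding continuous_map_def
proof (intro conjI allI impI)
  show "f \<circ> (\<lambda>(x, y). (snd x, y)) \<in> topspace (prod_topology (sum_topology X UNIV) K) \<rightarrow> topspace Z"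
    using assms by (force simp: continuous_map_def Pi_iff)
  fix U assume U: "openin Z U"
  let ?P = "{p \<in> topspace (prod_topology (sum_topology X UNIV) K). (f \<circ> (\<lambda>(x, y). (snd x, y))) p \<in> U}"
  show "openin (prod_topology (sum_topology X UNIV) K) ?P"
    unfolding openin_prod_topology_alt
  proof (intro allI impI)
    fix p y assume "(p, y) \<in> ?P"
    moreover obtain s x where p: "p = (s, x)" by (cases p)
    ultimately have xy: "x \<in> topspace (X s)" "y \<in> topspace K" "f (x, y) \<in> U" by auto
    have "openin (prod_topology (X s) K) {q \<in> topspace (prod_topology (X s) K). f q \<in> U}"
      using assms U by (simp add: continuous_map_def)
    then have "\<exists>V W. openin (X s) V \<and> openin K W \<and> x \<in> V \<and> y \<in> W \<and>
        V \<times> W \<subseteq> {q \<in> topspace (prod_topology (X s) K). f q \<in> U}"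
      unfolding openin_prod_topology_alt using xy by simp
    then obtain V W where V: "openin (X s) V" "openin K W" "x \<in> V" "y \<in> W"
      "V \<times> W \<subseteq> {q \<in> topspace (prod_topology (X s) K). f q \<in> U}"
      by blast
    have "openin (sum_topology X UNIV) ({s} \<times> V)"
    proof -
      have "{x. (i, x) \<in> {s} \<times> V} = (if i = s then V else {})" for i by auto
      then show ?thesis using V(1) openin_subset[OF V(1)] by (auto simp: openin_sum_topology)
    qed
    moreover have "({s} \<times> V) \<times> W \<subseteq> ?P" using V(5) by auto
    ultimately show "\<exists>V W. openin (sum_topology X UNIV) V \<and> openin K W \<and> p \<in> V \<and> y \<in> W \<and> V \<times> W \<subseteq> ?P"
      using V p by blast
  qed
qed

text \<open>The direct limit is a quotient of the disjoint sum, and the product of a quotient map with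
  a locally compact space is again a quotient map.\<close>

lemma continuous_map_prod_direct_limit:
  assumes K: "locally_compact_space K" "Hausdorff_space K"
    and f: "\<And>s. continuous_map (prod_topology (X s) K) Z f"
  shows "continuous_map (prod_topology (direct_limit_topology X) K) Z f"
proof (rule continuous_compose_quotient_map)
  show "quotient_map (prod_topology (sum_topology X UNIV) K) (prod_topology (direct_limit_topology X) K)
      (\<lambda>(x, y). (snd x, y))"
    using K by (intro quotient_map_prod_left quotient_map_sum_direct_limit) auto
  show "continuous_map (prod_topology (sum_topology X UNIV) K) Z (f \<circ> (\<lambda>(x, y). (snd x, y)))"
    using f by (rule continuous_map_prod_sum_topology)
qed

section \<open>Continuity of formulas in coordinates\<close>

lemma continuous_map_vec_lambda:
  assumes "\<And>i. continuous_map X euclidean (\<lambda>x. f x i)"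
  shows "continuous_map X euclidean (\<lambda>x. \<chi> i. f x i)"
  using assms by (auto simp: continuous_map_atin intro: tendsto_vec_lambda)

lemma continuous_map_vec_nth:
  "continuous_map X euclidean f \<Longrightarrow> continuous_map X euclidean (\<lambda>x. f x $ i)"
  by (auto simp: continuous_map_atin intro: tendsto_vec_nth)

text \<open>Function types carry the product topology, so on each stage \<open>coord_space s\<close>
  continuity reduces to that of polynomial expressions in single coordinates.\<close>

lemma continuous_map_coordinates:
  fixes f :: "'a \<Rightarrow> 'b \<Rightarrow> 'c::topological_space"
  shows "continuous_map X euclidean f \<longleftrightarrow> (\<forall>k. continuous_map X euclidean (\<lambda>x. f x k))"
  by (simp add: continuous_map_componentwise_UNIV flip: euclidean_product_topology)

lemma continuous_map_mult:
  fixes f g :: "'a \<Rightarrow> 'b::real_normed_algebra"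
  assumes "continuous_map X euclidean f" "continuous_map X euclidean g"
  shows "continuous_map X euclidean (\<lambda>x. f x * g x)"
  using assms by (auto simp: continuous_map_atin intro: tendsto_mult)

lemma continuous_map_cnj:
  "continuous_map X euclidean f \<Longrightarrow> continuous_map X euclidean (\<lambda>x. cnj (f x))"
  by (auto simp: continuous_map_atin intro: tendsto_cnj)

lemma continuous_map_fst_top_of_set:
  "continuous_map (prod_topology (top_of_set A) K) euclidean fst"
  by (rule continuous_map_into_fulltopology[OF continuous_map_fst])

lemma continuous_map_snd_top_of_set:
  "continuous_map (prod_topology K (top_of_set A)) euclidean snd"
  by (rule continuous_map_into_fulltopology[OF continuous_map_snd])

text \<open>Closedness in a locally compact space gives local compactness of the group, which
  \<open>continuous_map_prod_direct_limit\<close> asks of the second factor.\<close>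

lemma closed_unitary_group: "closed (unitary_group :: (complex ^ 'r ^ 'r) set)"
proof -
  have "unitary_group = {a :: complex ^ 'r ^ 'r. \<forall>i j. (\<Sum>k\<in>UNIV. a $ k $ i * cnj (a $ k $ j)) = (if i = j then 1 else 0)}"
    using unitary_columns unitary_groupI_columns by blast
  also have "closed \<dots>"
    by (intro closed_Collect_all closed_Collect_eq continuous_intros)
  finally show ?thesis .
qed

lemma locally_compact_unitary_group: "locally_compact_space (top_of_set (unitary_group :: (complex ^ 'r ^ 'r) set))"
  using closed_unitary_group
  by (intro locally_compact_space_closed_subset locally_compact_space_euclidean) simp

lemma Hausdorff_space_top_of_set: "Hausdorff_space (top_of_set (A :: 'a::metric_space set))"
  by (simp add: Hausdorff_space_subtopology Hausdorff_space_euclidean)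

text \<open>The action preserves every stage, hence its continuity can be tested between stages,
  where the coordinates are polynomial.\<close>

lemma frame_mult_in_frames:
  assumes "v \<in> frames s" "a \<in> unitary_group"
  shows "frame_mult v a \<in> frames s"
proof -
  have c: "v $ i \<in> coord_space s" for i using assms(1) by (simp add: frames_def)
  have cm: "frame_mult v a $ i \<in> coord_space s" for i
    unfolding frame_mult_def by (simp add: frame_comb_in_subspace[OF subspace_coord_space] c)
  have "v \<in> stiefel_set"
    using assms(1) by (auto simp: stiefel_def topspace_direct_limit_topology)
  from frame_mult_in_stiefel[OF this assms(2)] show ?thesis
    by (simp add: frames_def topspace_stiefel cm flip: herm_eq_sum[OF cm])
qed

lemma continuous_map_frame_mult:
  "continuous_map (prod_topology (stiefel :: ((nat \<Rightarrow> complex) ^ 'r) topology) (top_of_set unitary_group)) stiefel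
     (\<lambda>(v, a). frame_mult v a)"
proof -
  have "continuous_map (prod_topology (top_of_set (frames s)) (top_of_set unitary_group)) (top_of_set (frames s))
      (\<lambda>(v, a). frame_mult v a)" (is "continuous_map ?X _ _") for s :: nat
  proof (rule continuous_map_into_subtopology)
    have fst: "continuous_map ?X euclidean (\<lambda>p. (fst p $ i) k)" for i k
      using continuous_map_coordinates[THEN iffD1, OF continuous_map_vec_nth[OF continuous_map_fst_top_of_set]] ..
    have snd: "continuous_map ?X euclidean (\<lambda>p. snd p $ i $ j)" for i j
      by (intro continuous_map_vec_nth continuous_map_snd_top_of_set)
    show "continuous_map ?X euclidean (\<lambda>(v, a). frame_mult v a)"
      unfolding frame_mult_def case_prod_unfold
      by (intro continuous_map_vec_lambda continuous_map_coordinates[THEN iffD2] allI,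
          simp only: frame_comb_apply column_def vec_lambda_beta,
          intro continuous_map_sum continuous_map_mult fst snd finite)
  qed (auto simp: frame_mult_in_frames)
  then show ?thesis
    unfolding stiefel_def
    by (intro continuous_map_prod_direct_limit locally_compact_unitary_group Hausdorff_space_top_of_set)
      (rule continuous_map_into_direct_limit)
qed

lemma continuous_map_frame_comb:
  "continuous_map (prod_topology (stiefel :: ((nat \<Rightarrow> complex) ^ 'r) topology) euclidean) C_infinity
     (\<lambda>(v, y). frame_comb v y)"
proof -
  have "continuous_map (prod_topology (top_of_set (frames s)) euclidean) (top_of_set (coord_space s))
      (\<lambda>(v :: (nat \<Rightarrow> complex) ^ 'r, y). frame_comb v y)" (is "continuous_map ?X _ _") for s :: nat
  proof (rule continuous_map_into_subtopology)
    have fst: "continuous_map ?X euclidean (\<lambda>p. (fst p $ i) k)" for i k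
      using continuous_map_coordinates[THEN iffD1, OF continuous_map_vec_nth[OF continuous_map_fst_top_of_set]] ..
    have snd: "continuous_map ?X euclidean (\<lambda>p. snd p $ i)" for i
      by (intro continuous_map_vec_nth continuous_map_snd)
    show "continuous_map ?X euclidean (\<lambda>(v, y). frame_comb v y)"
      unfolding case_prod_unfold
      by (intro continuous_map_coordinates[THEN iffD2] allI,
          simp only: frame_comb_apply,
          intro continuous_map_sum continuous_map_mult fst snd finite)
  qed (auto simp: frames_def intro!: frame_comb_in_subspace[OF subspace_coord_space])
  then show ?thesis
    unfolding stiefel_def C_infinity_def
    by (intro continuous_map_prod_direct_limit locally_compact_space_euclidean Hausdorff_space_euclidean)
      (rule continuous_map_into_direct_limit)
qed

lemma continuous_map_frame_nth: "continuous_map stiefel C_infinity (\<lambda>v. v $ i)"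
proof -
  have "continuous_map (top_of_set (frames s)) (top_of_set (coord_space s)) (\<lambda>v. v $ i)" for s
    by (intro continuous_map_into_subtopology continuous_map_vec_nth) (auto simp: frames_def)
  then show ?thesis
    unfolding stiefel_def C_infinity_def continuous_map_direct_limit
    by (blast intro: continuous_map_into_direct_limit)
qed

section \<open>The action of the roots of unity on vectors and frames\<close>

lemma module_act_in_coord_space: "z \<in> coord_space s \<Longrightarrow> module_act \<gamma> z \<in> coord_space s"
  by (simp add: coord_space_def module_act_def)

lemma continuous_map_module_act: "continuous_map C_infinity C_infinity (module_act \<gamma>)"
proof -
  have "continuous_map (top_of_set (coord_space s)) (top_of_set (coord_space s)) (module_act \<gamma>)" for s
  proof (rule continuous_map_into_subtopology)
    have "continuous_map (top_of_set (coord_space s)) euclidean (\<lambda>z. z k)" for k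
      using continuous_map_coordinates[of "top_of_set (coord_space s)" "\<lambda>z. z"] by simp
    then show "continuous_map (top_of_set (coord_space s)) euclidean (module_act \<gamma>)"
      unfolding continuous_map_coordinates[of _ "module_act \<gamma>"] module_act_def
      by (intro allI continuous_map_mult) (rule continuous_map_const[THEN iffD2], simp)
  qed (auto simp: module_act_in_coord_space)
  then show ?thesis
    unfolding C_infinity_def continuous_map_direct_limit
    by (blast intro: continuous_map_into_direct_limit)
qed

text \<open>Roots of unity have modulus one. This is where \<open>n \<ge> 1\<close> enters:
  \<open>cyclic_roots 0\<close> is the whole complex plane.\<close>

lemma cyclic_roots_cnj:
  assumes "n \<ge> 1" "\<gamma> \<in> cyclic_roots n"
  shows "\<gamma> * cnj \<gamma> = 1"
proof -
  have "cmod \<gamma> = 1" using assms power_eq_1_iff[of \<gamma> n] by (auto simp: cyclic_roots_def)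
  then show ?thesis by (simp add: complex_norm_square[symmetric])
qed

text \<open>Coordinate \<open>k\<close> of both vectors is multiplied by the same number
  \<open>\<gamma> ^ (k + 1)\<close> of modulus one, so the twisted exponents do not disturb
  orthonormality.\<close>

lemma herm_module_act:
  assumes "\<gamma> * cnj \<gamma> = 1" "x \<in> finseq"
  shows "herm (module_act \<gamma> x) (module_act \<gamma> y) = herm x y"
proof -
  obtain s where s: "x \<in> coord_space s" using assms by (auto simp: finseq_def)
  have "module_act \<gamma> x k * cnj (module_act \<gamma> y k) = (\<gamma> * cnj \<gamma>) ^ (k + 1) * (x k * cnj (y k))" for k
    by (simp add: module_act_def power_mult_distrib mult_ac)
  then show ?thesis
    by (simp add: herm_eq_sum[OF s] herm_eq_sum[OF module_act_in_coord_space[OF s]] assms(1))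
qed

lemma stiefel_act_in_frames:
  assumes "\<gamma> * cnj \<gamma> = 1" "v \<in> frames s"
  shows "stiefel_act \<gamma> (mat 1) v \<in> frames s"
proof -
  have c: "v $ i \<in> coord_space s" for i using assms(2) by (simp add: frames_def)
  then have f: "v $ i \<in> finseq" for i by (auto simp: finseq_def)
  show ?thesis
    using assms(2)
    by (simp add: frames_def stiefel_act_mat_1 module_act_in_coord_space herm_module_act[OF assms(1) f]
        flip: herm_eq_sum[OF c] herm_eq_sum[OF module_act_in_coord_space[OF c]])
qed

lemma continuous_map_stiefel_act:
  assumes "\<gamma> * cnj \<gamma> = 1"
  shows "continuous_map stiefel stiefel (stiefel_act \<gamma> (mat 1))"
proof -
  have "continuous_map (top_of_set (frames s)) (top_of_set (frames s))
      (stiefel_act \<gamma> (mat 1) :: (nat \<Rightarrow> complex) ^ 'r \<Rightarrow> _)" (is "continuous_map ?X _ _") for s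
  proof (rule continuous_map_into_subtopology)
    have "continuous_map ?X euclidean (\<lambda>v. (v $ i) k)" for i k
      using continuous_map_vec_nth[of ?X "\<lambda>v. v" i] by (simp add: continuous_map_coordinates)
    then show "continuous_map ?X euclidean (stiefel_act \<gamma> (mat 1))"
      unfolding stiefel_act_mat_1
      by (intro continuous_map_vec_lambda continuous_map_coordinates[THEN iffD2] allI,
          unfold module_act_def, intro continuous_map_mult) (rule continuous_map_const[THEN iffD2], simp)
  qed (use assms in \<open>auto simp: stiefel_act_in_frames\<close>)
  then show ?thesis
    unfolding stiefel_def continuous_map_direct_limit
    by (blast intro: continuous_map_into_direct_limit)
qed

section \<open>Joint continuity of the inner product\<close>

definition l1_norm :: "(nat \<Rightarrow> complex) \<Rightarrow> real" where
  "l1_norm x = (\<Sum>k | x k \<noteq> 0. cmod (x k))"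

lemma l1_norm_eq_sum:
  assumes "x \<in> coord_space s"
  shows "l1_norm x = (\<Sum>k<s. cmod (x k))"
proof -
  have "{k. x k \<noteq> 0} \<subseteq> {..<s}"
    using assms by (force simp: coord_space_def not_le)
  then show ?thesis
    unfolding l1_norm_def by (intro sum.mono_neutral_left) auto
qed

lemma l1_norm_zero: "l1_norm 0 = 0"
  by (simp add: l1_norm_def)

text \<open>Replacing each \<open>cmod (y k)\<close> by the full sum \<open>l1_norm y\<close> is
  crude but enough for continuity, and needs no Cauchy-Schwarz inequality.\<close>

lemma norm_herm_le:
  assumes "x \<in> finseq" "y \<in> finseq"
  shows "cmod (herm x y) \<le> l1_norm x * l1_norm y"
proof -
  obtain s where s: "x \<in> coord_space s" "y \<in> coord_space s"
    using finseq_common_bound2 assms by blast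
  have "cmod (herm x y) \<le> (\<Sum>k<s. cmod (x k) * cmod (y k))"
    unfolding herm_eq_sum[OF s(1)] by (rule order_trans[OF norm_sum]) (simp add: norm_mult)
  also have "\<dots> \<le> (\<Sum>k<s. cmod (x k) * l1_norm y)"
    unfolding l1_norm_eq_sum[OF s(2)]
    by (intro sum_mono mult_left_mono member_le_sum) auto
  also have "\<dots> = l1_norm x * l1_norm y"
    by (simp add: l1_norm_eq_sum[OF s(1)] sum_distrib_right)
  finally show ?thesis .
qed

text \<open>On a stage the distance is a finite sum of continuous terms, and continuity on a direct
  limit is tested on its stages.\<close>

lemma continuous_map_l1_dist:
  assumes "a \<in> finseq"
  shows "continuous_map C_infinity euclidean (\<lambda>x. l1_norm (x - a))"
proof -
  have "continuous_map (top_of_set (coord_space s)) euclidean (\<lambda>x. l1_norm (x - a))" for s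
  proof -
    obtain t where t: "a \<in> coord_space t" using assms by (auto simp: finseq_def)
    \<comment> \<open>The centre \<open>a\<close> may lie beyond the stage \<open>s\<close>, so the
      sum has to run up to a bound for both.\<close>
    have "l1_norm (x - a) = (\<Sum>k<max s t. cmod (x k - a k))" if "x \<in> coord_space s" for x
      using that t l1_norm_eq_sum[of "x - a" "max s t"] by (simp add: coord_space_def)
    moreover have "continuous_map (top_of_set (coord_space s)) euclidean (\<lambda>x. x k)" for k
      using continuous_map_coordinates[of "top_of_set (coord_space s)" "\<lambda>x. x"] by simp
    then have "continuous_map (top_of_set (coord_space s)) euclidean (\<lambda>x. \<Sum>k<max s t. cmod (x k - a k))"
      by (intro continuous_map_sum continuous_map_norm continuous_map_diff) auto
    ultimately show ?thesis by (auto intro: continuous_map_eq)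
  qed
  then show ?thesis by (simp add: C_infinity_def continuous_map_direct_limit)
qed

text \<open>Every term on the right contains \<open>x - a\<close> or \<open>y - b\<close>, so
  \<open>norm_herm_le\<close> makes each of them small.\<close>

lemma herm_diff:
  assumes "x \<in> finseq" "y \<in> finseq" "a \<in> finseq" "b \<in> finseq"
  shows "herm x y - herm a b = herm (x - a) (y - b) + herm (x - a) b + herm a (y - b)"
proof -
  obtain s where s: "x \<in> coord_space s" "a \<in> coord_space s"
    using finseq_common_bound2 assms by blast
  then have "x - a \<in> coord_space s" by (simp add: coord_space_def)
  with s show ?thesis
    by (simp add: herm_eq_sum[of _ s] sum.distrib sum_subtractf algebra_simps)
qed

text \<open>The product topology on \<open>C_infinity \<times> C_infinity\<close> is not obviously a direct limit; continuity
  holds because the \<open>l1\<close>-norm is continuous for the direct limit topology.\<close>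

lemma continuous_map_herm:
  "continuous_map (prod_topology C_infinity C_infinity) euclidean (\<lambda>(x, y). herm x y)"
  unfolding continuous_map_atin
proof
  fix p assume pt: "p \<in> topspace (prod_topology C_infinity C_infinity)"
  then obtain a b where p: "p = (a, b)" "a \<in> finseq" "b \<in> finseq"
    by (auto simp: topspace_C_infinity)
  let ?F = "atin (prod_topology C_infinity C_infinity) p"
  let ?u = "\<lambda>q. l1_norm (fst q - a)" and ?w = "\<lambda>q. l1_norm (snd q - b)"
  have "continuous_map (prod_topology C_infinity C_infinity) euclidean ?u"
    using continuous_map_compose[OF continuous_map_fst continuous_map_l1_dist[OF p(2)]] by (simp add: o_def)
  then have "(?u \<longlongrightarrow> ?u p) ?F"
    using pt unfolding continuous_map_atin limitin_canonical_iff by blast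
  then have u: "(?u \<longlongrightarrow> 0) ?F"
    using p by (simp add: l1_norm_zero)
  have "continuous_map (prod_topology C_infinity C_infinity) euclidean ?w"
    using continuous_map_compose[OF continuous_map_snd continuous_map_l1_dist[OF p(3)]] by (simp add: o_def)
  then have "(?w \<longlongrightarrow> ?w p) ?F"
    using pt unfolding continuous_map_atin limitin_canonical_iff by blast
  then have w: "(?w \<longlongrightarrow> 0) ?F"
    using p by (simp add: l1_norm_zero)
  have "cmod (herm x y - herm a b) \<le> ?u (x, y) * ?w (x, y) + ?u (x, y) * l1_norm b + l1_norm a * ?w (x, y)"
    if "x \<in> finseq" "y \<in> finseq" for x y
  proof -
    have d: "x - a \<in> finseq" "y - b \<in> finseq"
      using that p cseq.subspace_diff[OF subspace_finseq] by auto
    have "cmod (herm (x - a) (y - b) + herm (x - a) b + herm a (y - b))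
        \<le> cmod (herm (x - a) (y - b)) + cmod (herm (x - a) b) + cmod (herm a (y - b))"
      by (meson add_right_mono norm_triangle_ineq order_trans)
    also have "\<dots> \<le> ?u (x, y) * ?w (x, y) + ?u (x, y) * l1_norm b + l1_norm a * ?w (x, y)"
      by (simp add: add_mono norm_herm_le d p)
    finally show ?thesis using that p by (simp add: herm_diff)
  qed
  \<comment> \<open>The estimate holds on the whole space, which therefore serves as the
    neighbourhood of \<open>p\<close>.\<close>
  then have "eventually (\<lambda>q. norm ((case q of (x, y) \<Rightarrow> herm x y) - herm a b)
      \<le> ?u q * ?w q + ?u q * l1_norm b + l1_norm a * ?w q) ?F"
    by (auto simp: eventually_atin topspace_C_infinity intro!: exI[of _ "finseq \<times> finseq"])
       (use openin_topspace[of "prod_topology C_infinity C_infinity"] p in \<open>simp add: topspace_C_infinity\<close>)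
  from this _ have "((\<lambda>q. (case q of (x, y) \<Rightarrow> herm x y) - herm a b) \<longlongrightarrow> 0) ?F"
  proof (rule Lim_null_comparison)
    have "((\<lambda>q. ?u q * ?w q + ?u q * l1_norm b + l1_norm a * ?w q) \<longlongrightarrow> 0 * 0 + 0 * l1_norm b + l1_norm a * 0) ?F"
      by (intro tendsto_intros u w)
    then show "((\<lambda>q. ?u q * ?w q + ?u q * l1_norm b + l1_norm a * ?w q) \<longlongrightarrow> 0) ?F"
      by simp
  qed
  then show "limitin euclidean (\<lambda>(x, y). herm x y) (case p of (x, y) \<Rightarrow> herm x y) ?F"
    using p by (simp add: LIM_zero_iff)
qed

lemma continuous_map_herm_compose:
  assumes "continuous_map X C_infinity f" "continuous_map X C_infinity g"
  shows "continuous_map X euclidean (\<lambda>x. herm (f x) (g x))"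
  using continuous_map_compose[OF continuous_map_pairedI[OF assms] continuous_map_herm] by (simp add: o_def)

lemma continuous_map_frame_nth_compose:
  "continuous_map X stiefel f \<Longrightarrow> continuous_map X C_infinity (\<lambda>x. f x $ i)"
  using continuous_map_compose[OF _ continuous_map_frame_nth] by (fastforce simp: o_def)

lemma continuous_map_frame_coords:
  assumes "continuous_map X stiefel f" "continuous_map X C_infinity g"
  shows "continuous_map X euclidean (\<lambda>x. frame_coords (f x) (g x))"
  unfolding frame_coords_def
  by (intro continuous_map_vec_lambda continuous_map_herm_compose continuous_map_frame_nth_compose assms)

lemma continuous_map_frame_change:
  assumes "continuous_map X stiefel f" "continuous_map X stiefel g"
  shows "continuous_map X euclidean (\<lambda>x. frame_change (f x) (g x))"
  unfolding frame_change_def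
  by (intro continuous_map_vec_lambda continuous_map_herm_compose continuous_map_frame_nth_compose assms)

lemma continuous_map_frame_comb_compose:
  assumes "continuous_map X stiefel f" "continuous_map X euclidean g"
  shows "continuous_map X C_infinity (\<lambda>x. frame_comb (f x) (g x))"
  using continuous_map_compose[OF continuous_map_pairedI[OF assms] continuous_map_frame_comb] by (simp add: o_def)

lemma continuous_map_frame_mult_compose:
  assumes "continuous_map X stiefel f" "continuous_map X euclidean g" "\<And>x. x \<in> topspace X \<Longrightarrow> g x \<in> unitary_group"
  shows "continuous_map X stiefel (\<lambda>x. frame_mult (f x) (g x))"
proof -
  have "continuous_map X (top_of_set unitary_group) g"
    using assms by (auto intro: continuous_map_into_subtopology)
  from continuous_map_compose[OF continuous_map_pairedI[OF assms(1) this] continuous_map_frame_mult]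
  show ?thesis by (simp add: o_def)
qed

section \<open>Equivariant Gram-Schmidt orthonormalisation\<close>

definition vherm :: "complex ^ 'r \<Rightarrow> complex ^ 'r \<Rightarrow> complex" where
  "vherm x y = (\<Sum>k\<in>UNIV. x $ k * cnj (y $ k))"

text \<open>Because \<open>1 / 0 = 0\<close>, the zero vector is sent to itself, and the recursion
  below makes sense for dependent vectors as well.\<close>

definition normalise :: "complex ^ 'r \<Rightarrow> complex ^ 'r" where
  "normalise x = of_real (1 / sqrt (Re (vherm x x))) *s x"

text \<open>The vectors are indexed by natural numbers because the procedure depends on an order,
  which the finite index type \<open>'r\<close> does not provide.\<close>

function gram_schmidt :: "(nat \<Rightarrow> complex ^ 'r) \<Rightarrow> nat \<Rightarrow> complex ^ 'r" where
  "gram_schmidt a j = normalise (a j - (\<Sum>i<j. vherm (a j) (gram_schmidt a i) *s gram_schmidt a i))"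
  by auto
termination by (relation "inv_image less_than snd") auto

declare gram_schmidt.simps [simp del]

text \<open>The vector before normalisation is kept separate: the nonvanishing of these residuals is
  linear independence, and it describes the domain on which the procedure is continuous.\<close>

definition residual :: "(nat \<Rightarrow> complex ^ 'r) \<Rightarrow> nat \<Rightarrow> complex ^ 'r" where
  "residual a j = a j - (\<Sum>i<j. vherm (a j) (gram_schmidt a i) *s gram_schmidt a i)"

lemma gram_schmidt_eq: "gram_schmidt a j = normalise (residual a j)"
  by (simp add: residual_def gram_schmidt.simps[of a j])

lemma vherm_add_left: "vherm (x + y) z = vherm x z + vherm y z"
  by (simp add: vherm_def distrib_right sum.distrib)

lemma vherm_diff_left: "vherm (x - y) z = vherm x z - vherm y z"
  by (simp add: vherm_def left_diff_distrib sum_subtractf)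

lemma vherm_scale_left: "vherm (c *s x) z = c * vherm x z"
  by (simp add: vherm_def sum_distrib_left mult.assoc)

lemma vherm_scale_right: "vherm x (c *s z) = cnj c * vherm x z"
  by (simp add: vherm_def sum_distrib_left mult_ac)

lemma vherm_sum_left: "vherm (\<Sum>i\<in>I. f i) z = (\<Sum>i\<in>I. vherm (f i) z)"
  by (induction I rule: infinite_finite_induct) (simp_all add: vherm_add_left, simp_all add: vherm_def)

lemma vherm_commute: "vherm y x = cnj (vherm x y)"
  by (simp add: vherm_def mult.commute)

lemma vherm_self: "vherm x x = of_real (\<Sum>k\<in>UNIV. (cmod (x $ k))\<^sup>2)"
  by (simp add: vherm_def flip: complex_norm_square)

lemma vherm_self_pos:
  assumes "x \<noteq> 0"
  shows "Re (vherm x x) > 0"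
proof -
  obtain k where "x $ k \<noteq> 0" using assms by (auto simp: vec_eq_iff)
  then have "(\<Sum>k\<in>UNIV. (cmod (x $ k))\<^sup>2) > 0"
    by (intro sum_pos2[of _ k]) auto
  then show ?thesis by (simp add: vherm_self del: of_real_sum)
qed

lemma vherm_normalise:
  assumes "x \<noteq> 0"
  shows "vherm (normalise x) (normalise x) = 1"
proof -
  define r where "r = Re (vherm x x)"
  have r: "r > 0" "vherm x x = of_real r"
    using vherm_self_pos[OF assms] by (auto simp: r_def vherm_self simp del: of_real_sum)
  have "vherm (normalise x) (normalise x) = of_real (1 / sqrt r * (1 / sqrt r * r))"
    by (simp only: normalise_def vherm_scale_left vherm_scale_right complex_cnj_complex_of_real
        of_real_mult r(2) Re_complex_of_real)
  also have "1 / sqrt r * (1 / sqrt r * r) = 1"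
    using r(1) by (simp add: field_simps)
  finally show ?thesis by simp
qed

text \<open>Induction on the larger index. When the residual of \<open>a j\<close> is paired with
  \<open>gram_schmidt a i\<close>, only the summand \<open>l = i\<close> survives, and it cancels
  \<open>vherm (a j) (gram_schmidt a i)\<close>.\<close>

lemma vherm_gram_schmidt_less:
  assumes "\<And>i. i < m \<Longrightarrow> residual a i \<noteq> 0" "i < j" "j < m"
  shows "vherm (gram_schmidt a j) (gram_schmidt a i) = 0"
  using assms(2,3)
proof (induction j arbitrary: i rule: less_induct)
  case (less j)
  \<comment> \<open>Below \<open>j\<close> orthonormality is already known: the induction hypothesis
    is applied at the larger of \<open>l\<close> and \<open>i\<close>.\<close>
  have gs: "vherm (gram_schmidt a l) (gram_schmidt a i) = (if l = i then 1 else 0)" if "l < j" for l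
  proof (cases l i rule: linorder_cases)
    case less
    then have "vherm (gram_schmidt a i) (gram_schmidt a l) = 0"
      using less.IH[of i l] less.prems by simp
    with less show ?thesis by (simp add: vherm_commute[of "gram_schmidt a l"])
  next
    case equal
    then show ?thesis using assms(1)[of i] less.prems by (simp add: gram_schmidt_eq vherm_normalise)
  next
    case greater
    then show ?thesis using less.IH[of l i] less.prems that by simp
  qed
  have "(\<Sum>l<j. vherm (a j) (gram_schmidt a l) * vherm (gram_schmidt a l) (gram_schmidt a i))
      = (\<Sum>l<j. if l = i then vherm (a j) (gram_schmidt a i) else 0)"
    by (rule sum.cong) (auto simp: gs)
  then have "vherm (residual a j) (gram_schmidt a i) = 0"
    using less.prems by (simp add: residual_def vherm_diff_left vherm_sum_left vherm_scale_left)
  then show ?case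
    by (simp add: gram_schmidt_eq[of a j] normalise_def[of "residual a j"] vherm_scale_left)
qed

lemma gram_schmidt_orthonormal:
  assumes "\<And>i. i < m \<Longrightarrow> residual a i \<noteq> 0" "i < m" "j < m"
  shows "vherm (gram_schmidt a i) (gram_schmidt a j) = (if i = j then 1 else 0)"
proof (cases i j rule: linorder_cases)
  case less
  then show ?thesis
    using vherm_gram_schmidt_less[of m a i j] assms by (simp add: vherm_commute[of "gram_schmidt a i"])
next
  case equal
  then show ?thesis using assms by (simp add: gram_schmidt_eq vherm_normalise)
next
  case greater
  then show ?thesis using vherm_gram_schmidt_less[of m a j i] assms by simp
qed

text \<open>Applied to the rows of the identity matrix, which has to lie in the domain of the map
  into the unitary group.\<close>

lemma residual_of_orthonormal:
  assumes "\<And>i j. i < m \<Longrightarrow> j < m \<Longrightarrow> vherm (a i) (a j) = (if i = j then 1 else 0)"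
  shows "j < m \<Longrightarrow> residual a j = a j"
proof (induction j rule: less_induct)
  case (less j)
  have "vherm (a j) (gram_schmidt a i) = 0" if "i < j" for i
  proof -
    have "gram_schmidt a i = normalise (a i)" using less that by (simp add: gram_schmidt_eq)
    then show ?thesis using assms[of j i] that less.prems by (simp add: normalise_def vherm_scale_right)
  qed
  then show ?case by (simp add: residual_def)
qed

lemma vherm_mult_unitary:
  assumes "u \<in> unitary_group"
  shows "vherm (x v* u) (y v* u) = vherm x y"
proof -
  have rows: "(\<Sum>k\<in>UNIV. u $ i $ k * cnj (u $ j $ k)) = (if i = j then 1 else 0)" for i j
  proof -
    have "(u ** conj_transpose u) $ i $ j = mat 1 $ i $ j"
      using assms by (simp add: unitary_group_def)
    then show ?thesis by (simp add: matrix_matrix_mult_def conj_transpose_def mat_def)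
  qed
  have "vherm (x v* u) (y v* u)
      = (\<Sum>k\<in>UNIV. \<Sum>i\<in>UNIV. \<Sum>j\<in>UNIV. x $ i * cnj (y $ j) * (u $ i $ k * cnj (u $ j $ k)))"
    by (simp add: vherm_def vector_matrix_mult_def sum_product mult_ac)
  \<comment> \<open>The sum over \<open>k\<close> is moved innermost, where orthonormality of the
    rows of \<open>u\<close> evaluates it.\<close>
  also have "\<dots> = (\<Sum>i\<in>UNIV. \<Sum>k\<in>UNIV. \<Sum>j\<in>UNIV. x $ i * cnj (y $ j) * (u $ i $ k * cnj (u $ j $ k)))"
    by (rule sum.swap)
  also have "\<dots> = (\<Sum>i\<in>UNIV. \<Sum>j\<in>UNIV. \<Sum>k\<in>UNIV. x $ i * cnj (y $ j) * (u $ i $ k * cnj (u $ j $ k)))"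
    by (rule sum.cong[OF refl], rule sum.swap)
  also have "\<dots> = (\<Sum>i\<in>UNIV. \<Sum>j\<in>UNIV. x $ i * cnj (y $ j) * (if i = j then 1 else 0))"
    by (simp only: rows flip: sum_distrib_left)
  also have "\<dots> = (\<Sum>i\<in>UNIV. \<Sum>j\<in>UNIV. if j = i then x $ i * cnj (y $ i) else 0)"
    by (intro sum.cong refl) auto
  also have "\<dots> = vherm x y" by (simp add: vherm_def)
  finally show ?thesis .
qed

lemma vector_matrix_mult_scale: "(c *s x) v* (u :: 'a::comm_semiring_1 ^ 'n ^ 'm) = c *s (x v* u)"
  by (simp add: vec_eq_iff vector_matrix_mult_def sum_distrib_left mult_ac)

lemma vector_matrix_mult_diff: "(x - y) v* (u :: 'a::comm_ring_1 ^ 'n ^ 'm) = x v* u - y v* u"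
  by (simp add: vec_eq_iff vector_matrix_mult_def left_diff_distrib sum_subtractf)

lemma vector_matrix_mult_sum: "(\<Sum>i\<in>I. f i) v* (u :: 'a::comm_ring_1 ^ 'n ^ 'm) = (\<Sum>i\<in>I. f i v* u)"
  by (induction I rule: infinite_finite_induct)
    (simp_all add: vec_eq_iff vector_matrix_mult_def distrib_right sum.distrib)

text \<open>The procedure uses only inner products, which a unitary matrix preserves, and linear
  combinations, with which it commutes.\<close>

lemma residual_mult_unitary:
  assumes u: "u \<in> unitary_group"
  shows "residual (\<lambda>i. a i v* u) j = residual a j v* u"
proof (induction j rule: less_induct)
  case (less j)
  have "gram_schmidt (\<lambda>i. a i v* u) i = gram_schmidt a i v* u" if "i < j" for i
    using less[OF that] by (simp add: gram_schmidt_eq normalise_def vherm_mult_unitary[OF u] vector_matrix_mult_scale)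
  then show ?case
    by (simp add: residual_def vherm_mult_unitary[OF u] vector_matrix_mult_scale
        vector_matrix_mult_diff vector_matrix_mult_sum)
qed

lemma gram_schmidt_mult_unitary:
  assumes "u \<in> unitary_group"
  shows "gram_schmidt (\<lambda>i. a i v* u) j = gram_schmidt a j v* u"
  by (simp add: gram_schmidt_eq normalise_def residual_mult_unitary vherm_mult_unitary
      vector_matrix_mult_scale assms)

lemma vector_matrix_mult_unitary_eq_0:
  assumes "u \<in> unitary_group"
  shows "x v* u = 0 \<longleftrightarrow> x = 0"
proof
  assume "x v* u = 0"
  then have "vherm x x = 0" using vherm_mult_unitary[OF assms, of x x] by (simp add: vherm_def)
  then show "x = 0" using vherm_self_pos[of x] by force
next
  show "x = 0 \<Longrightarrow> x v* u = 0" by (simp add: vector_matrix_mult_def vec_eq_iff)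
qed

lemma continuous_on_vherm [continuous_intros]:
  "continuous_on S f \<Longrightarrow> continuous_on S g \<Longrightarrow> continuous_on S (\<lambda>x. vherm (f x) (g x))"
  unfolding vherm_def by (intro continuous_intros)

lemma continuous_on_vscale [continuous_intros]:
  "continuous_on S f \<Longrightarrow> continuous_on S g \<Longrightarrow> continuous_on S (\<lambda>x. f x *s (g x :: complex ^ 'r))"
  unfolding vector_scalar_mult_def by (intro continuous_intros)

lemma continuous_on_normalise:
  assumes "continuous_on S f" "\<And>x. x \<in> S \<Longrightarrow> f x \<noteq> 0"
  shows "continuous_on S (\<lambda>x. normalise (f x))"
proof -
  have "sqrt (Re (vherm (f x) (f x))) \<noteq> 0" if "x \<in> S" for x
    using vherm_self_pos[OF assms(2)[OF that]] by simp
  then show ?thesis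
    unfolding normalise_def by (intro continuous_intros assms(1)) auto
qed

text \<open>The claims must be proved together: residual \<open>m\<close> involves the
  orthonormalised vectors below \<open>m\<close> and is continuous where the earlier residuals do
  not vanish, and this continuity in turn makes the next, smaller domain open. Hence
  \<open>j \<le> m\<close> for residuals but \<open>j < m\<close> for normalised vectors.\<close>

lemma residual_open_continuous:
  fixes F :: "'a::topological_space \<Rightarrow> nat \<Rightarrow> complex ^ 'r"
  assumes F: "\<And>i. continuous_on UNIV (\<lambda>x. F x i)"
  defines "W \<equiv> \<lambda>m. {x. \<forall>i<m. residual (F x) i \<noteq> 0}"
  shows "open (W m) \<and> (\<forall>j\<le>m. continuous_on (W m) (\<lambda>x. residual (F x) j))
     \<and> (\<forall>j<m. continuous_on (W m) (\<lambda>x. gram_schmidt (F x) j))"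
proof (induction m)
  case 0
  then show ?case using F by (simp add: W_def residual_def)
next
  case (Suc m)
  have W: "W (Suc m) = {x \<in> W m. residual (F x) m \<noteq> 0}"
    by (auto simp: W_def less_Suc_eq)
  then have sub: "W (Suc m) \<subseteq> W m" by blast
  have "W (Suc m) = W m \<inter> (\<lambda>x. residual (F x) m) -` (- {0})" using W by auto
  moreover have "open (W m \<inter> (\<lambda>x. residual (F x) m) -` (- {0}))"
    by (rule continuous_open_preimage) (use Suc in auto)
  ultimately have op: "open (W (Suc m))" by simp
  have gs: "continuous_on (W (Suc m)) (\<lambda>x. gram_schmidt (F x) j)" if "j < Suc m" for j
  proof -
    have "continuous_on (W (Suc m)) (\<lambda>x. residual (F x) j)"
      using Suc that by (intro continuous_on_subset[OF _ sub]) auto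
    then show ?thesis
      unfolding gram_schmidt_eq using that by (intro continuous_on_normalise) (auto simp: W_def)
  qed
  have "continuous_on (W (Suc m)) (\<lambda>x. residual (F x) j)" if "j \<le> Suc m" for j
    unfolding residual_def
    by (intro continuous_intros continuous_on_subset[OF F] gs) (use that in auto)
  with op gs show ?case by blast
qed

text \<open>Orthonormalising the rows is equivariant under right multiplication by unitary matrices;
  this is what makes the local sections of the Stiefel bundle below well defined.\<close>

lemma unitary_retraction:
  obtains W :: "(complex ^ 'r ^ 'r) set" and q where "open W" "mat 1 \<in> W"
    "continuous_on W q" "\<And>a. a \<in> W \<Longrightarrow> q a \<in> unitary_group"
    "\<And>a u. a \<in> W \<Longrightarrow> u \<in> unitary_group \<Longrightarrow> a ** u \<in> W \<and> q (a ** u) = q a ** u"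
proof -
  \<comment> \<open>Any enumeration of the row indices will do.\<close>
  obtain e where e: "bij_betw e (UNIV :: 'r set) {0..<CARD('r)}"
    using ex_bij_betw_finite_nat[OF finite] by blast
  define e' where "e' = inv_into UNIV e"
  define F where "F a i = a $ e' i" for a :: "complex ^ 'r ^ 'r" and i
  have e_less: "e i < CARD('r)" and e'_e: "e' (e i) = i" for i
    using e by (auto simp: e'_def bij_betw_def)
  have e_inj: "e i = e j \<longleftrightarrow> i = j" for i j
    using e by (auto simp: bij_betw_def inj_on_def)
  have e'_inj: "e' i = e' j \<longleftrightarrow> i = j" if "i < CARD('r)" "j < CARD('r)" for i j
  proof -
    have "e (e' i) = i" "e (e' j) = j"
      using that e by (auto simp: e'_def bij_betw_def f_inv_into_f)
    then show ?thesis by metis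
  qed
  define W where "W = {a. \<forall>i<CARD('r). residual (F a) i \<noteq> 0}"
  define q where "q a = (\<chi> i. gram_schmidt (F a) (e i))" for a
  have F: "continuous_on UNIV (\<lambda>a. F a i)" for i
    unfolding F_def by (intro continuous_intros)
  \<comment> \<open>Right multiplication acts on each row separately, which is why rows rather than
    columns are orthonormalised.\<close>
  have Fu: "F (a ** u) = (\<lambda>i. F a i v* u)" for a u
    by (simp add: fun_eq_iff F_def vec_eq_iff matrix_matrix_mult_def vector_matrix_mult_def mult.commute)
  note oc = residual_open_continuous[of F "CARD('r)", OF F, folded W_def]
  show ?thesis
  proof
    show "open W" using oc by blast
    show "continuous_on W q"
      unfolding q_def using oc e_less by (intro continuous_intros) auto
    have "vherm (F (mat 1) i) (F (mat 1) j) = (if i = j then 1 else 0)" if "i < CARD('r)" "j < CARD('r)" for i j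
    proof -
      have "vherm (F (mat 1) i) (F (mat 1) j) = (\<Sum>k\<in>UNIV. if k = e' i then if e' i = e' j then 1 else 0 else 0)"
        unfolding vherm_def F_def by (rule sum.cong) (auto simp: mat_def)
      then show ?thesis using that by (simp add: e'_inj)
    qed
    then have res: "residual (F (mat 1)) i = F (mat 1) i" "vherm (F (mat 1) i) (F (mat 1) i) = 1" if "i < CARD('r)" for i
      using residual_of_orthonormal[of "CARD('r)" "F (mat 1)" i] that by simp_all
    have "residual (F (mat 1)) i \<noteq> 0" if "i < CARD('r)" for i
    proof
      assume "residual (F (mat 1)) i = 0"
      then have "F (mat 1) i = 0" using res(1)[OF that] by simp
      then have "vherm (F (mat 1) i) (F (mat 1) i) = 0" by (simp add: vherm_def)
      with res(2)[OF that] show False by simp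
    qed
    then show "mat 1 \<in> W" by (simp add: W_def)
    show "q a \<in> unitary_group" if "a \<in> W" for a
    proof (rule unitary_groupI_rows)
      fix i j
      have "vherm (gram_schmidt (F a) (e i)) (gram_schmidt (F a) (e j)) = (if e i = e j then 1 else 0)"
        using that e_less by (intro gram_schmidt_orthonormal[of "CARD('r)"]) (auto simp: W_def)
      then show "(\<Sum>k\<in>UNIV. q a $ i $ k * cnj (q a $ j $ k)) = (if i = j then 1 else 0)"
        by (simp add: q_def vherm_def e_inj)
    qed
    show "a ** u \<in> W \<and> q (a ** u) = q a ** u" if "a \<in> W" "u \<in> unitary_group" for a u
    proof
      show "a ** u \<in> W"
        using that by (simp add: W_def Fu residual_mult_unitary vector_matrix_mult_unitary_eq_0)
      have "(q a ** u) $ i = q a $ i v* u" for i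
        by (simp add: vec_eq_iff matrix_matrix_mult_def vector_matrix_mult_def mult.commute)
      then have "q (a ** u) $ i = (q a ** u) $ i" for i
        by (simp add: q_def Fu gram_schmidt_mult_unitary that)
      then show "q (a ** u) = q a ** u"
        unfolding vec_eq_iff[of "q (a ** u)" "q a ** u"] by blast
    qed
  qed
qed

section \<open>The Grassmannian and local sections\<close>

text \<open>Gram-Schmidt once more, now for sequences and sets: only existence matters here, so
  neither an order nor continuity is tracked.\<close>

lemma orthonormal_set_exists:
  assumes "finite B" "cseq.independent B" "B \<subseteq> finseq"
  shows "\<exists>S. finite S \<and> card S = card B \<and> S \<subseteq> finseq \<and>
    (\<forall>x\<in>S. \<forall>y\<in>S. herm x y = (if x = y then 1 else 0)) \<and> cseq.span S = cseq.span B"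
  using assms
proof (induction B rule: finite_induct)
  case empty
  then show ?case by (intro exI[of _ "{}"]) auto
next
  case (insert b B)
  then have b: "b \<notin> cseq.span B" "b \<in> finseq" and indep: "cseq.independent B"
    by (auto simp: cseq.independent_insert)
  with insert obtain S where S: "finite S" "card S = card B" "S \<subseteq> finseq"
    and orth: "\<And>x y. x \<in> S \<Longrightarrow> y \<in> S \<Longrightarrow> herm x y = (if x = y then 1 else 0)"
    and span: "cseq.span S = cseq.span B" by auto
  \<comment> \<open>\<open>p\<close> is the orthogonal projection of \<open>b\<close> to the span of
    \<open>S\<close>. The difference \<open>w\<close> is nonzero because \<open>b\<close> lies
    outside that span.\<close>
  define p where "p = (\<Sum>x\<in>S. cscale (herm b x) x)"
  define w where "w = b - p"
  define r where "r = Re (herm w w)"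
  define u where "u = cscale (of_real (1 / sqrt r)) w"
  have cf: "cscale c x \<in> finseq" if "x \<in> finseq" for c x
    using that subspace_finseq by (simp add: cseq.subspace_def)
  have p_span: "p \<in> cseq.span S"
    unfolding p_def by (intro cseq.span_sum cseq.span_scale cseq.span_base)
  have p: "p \<in> finseq"
    unfolding p_def using S cf by (intro cseq.subspace_sum[OF subspace_finseq]) auto
  have w: "w \<in> finseq" unfolding w_def by (rule cseq.subspace_diff[OF subspace_finseq b(2) p])
  have w0: "w \<noteq> 0" using b(1) p_span span by (auto simp: w_def)
  have herm_w: "herm w x = 0" if "x \<in> S" for x
  proof -
    have "herm p x = (\<Sum>y\<in>S. herm (cscale (herm b y) y) x)"
      unfolding p_def using S cf by (intro herm_sum_left) auto
    also have "\<dots> = (\<Sum>y\<in>S. if y = x then herm b x else 0)"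
      using S that by (intro sum.cong refl) (auto simp: herm_cscale_left orth)
    finally have "herm p x = herm b x" using S that by simp
    moreover have "herm b x = herm w x + herm p x"
      using herm_add_left[OF w p, of x] by (simp add: w_def)
    ultimately show ?thesis by simp
  qed
  have r: "r > 0" "herm w w = of_real r"
    using herm_self_pos[OF w w0] herm_self_real[OF w] by (auto simp: r_def)
  have u: "u \<in> finseq" by (simp add: u_def cf w)
  have "herm u u = of_real (1 / sqrt r * (1 / sqrt r * r))"
    by (simp only: u_def herm_cscale_left herm_cscale_right w cf complex_cnj_complex_of_real of_real_mult r(2))
  also have "1 / sqrt r * (1 / sqrt r * r) = 1" using r(1) by (simp add: field_simps)
  finally have uu: "herm u u = 1" by simp
  have ux: "herm u x = 0" "herm x u = 0" if "x \<in> S" for x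
  proof -
    show "herm u x = 0" by (simp add: u_def herm_cscale_left w herm_w that)
    then show "herm x u = 0" using herm_commute[of u x] u S that by auto
  qed
  then have "u \<notin> S" using uu by auto
  \<comment> \<open>Solving for \<open>b\<close> places it in the new span; together with the
    definition of \<open>u\<close> this gives equality of the two spans.\<close>
  have bu: "b = cscale (of_real (sqrt r)) u + p"
    using r(1) by (simp add: u_def w_def)
  have mono: "cseq.span S \<subseteq> cseq.span (insert u S)" "cseq.span B \<subseteq> cseq.span (insert b B)"
    by (intro cseq.span_mono subset_insertI)+
  have "b \<in> cseq.span (insert u S)"
    unfolding bu using mono(1) p_span by (intro cseq.span_add cseq.span_scale) (auto simp: cseq.span_base)
  moreover have "u \<in> cseq.span (insert b B)"
    unfolding u_def w_def using mono(2) p_span span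
    by (intro cseq.span_scale cseq.span_diff) (auto simp: cseq.span_base)
  moreover have "S \<subseteq> cseq.span (insert b B)" "B \<subseteq> cseq.span (insert u S)"
    using mono span cseq.span_superset[of S] cseq.span_superset[of B] by auto
  ultimately have "cseq.span (insert u S) = cseq.span (insert b B)"
    by (simp add: cseq.span_eq)
  moreover have "\<forall>x\<in>insert u S. \<forall>y\<in>insert u S. herm x y = (if x = y then 1 else 0)"
    using \<open>u \<notin> S\<close> uu ux orth by (metis insert_iff)
  moreover have "finite (insert u S)" "card (insert u S) = card (insert b B)" "insert u S \<subseteq> finseq"
    using S \<open>u \<notin> S\<close> insert.hyps u by simp_all
  ultimately show ?case by blast
qed

lemma frame_exists:
  assumes "N \<in> grassmannian_set TYPE('r::finite)"
  obtains v :: "(nat \<Rightarrow> complex) ^ 'r" where "v \<in> stiefel_set" "frame_span v = N"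
proof -
  have N: "cseq.subspace N" "N \<subseteq> finseq" "cseq.dim N = CARD('r)"
    using assms by (auto simp: grassmannian_set_def topspace_C_infinity)
  obtain B where B: "B \<subseteq> N" "cseq.independent B" "N \<subseteq> cseq.span B" "card B = CARD('r)"
    using cseq.basis_exists[of N] N(3) by metis
  \<comment> \<open>Infinite sets have cardinality 0, whereas \<open>CARD('r)\<close> is
    positive.\<close>
  have "finite B" using B(4) by (metis card.infinite zero_less_card_finite less_numeral_extra(3))
  from orthonormal_set_exists[OF this B(2) subset_trans[OF B(1) N(2)]] obtain S where S: "finite S" "card S = CARD('r)" "S \<subseteq> finseq"
    "\<forall>x\<in>S. \<forall>y\<in>S. herm x y = (if x = y then 1 else 0)" "cseq.span S = cseq.span B" unfolding B(4) by blast
  have "cseq.span B = N" using B N(1) by (simp add: cseq.span_subspace)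
  obtain e :: "'r \<Rightarrow> _" where e: "bij_betw e UNIV S"
    using finite_same_card_bij[of "UNIV :: 'r set" S] S by auto
  define v :: "(nat \<Rightarrow> complex) ^ 'r" where "v = (\<chi> i. e i)"
  have eS: "e i \<in> S" "e i = e j \<longleftrightarrow> i = j" for i j
    using e by (auto simp: bij_betw_def inj_on_def)
  have "v \<in> stiefel_set"
    using S eS by (auto simp: topspace_stiefel v_def)
  moreover have "frame_span v = N"
    using e S(5) \<open>cseq.span B = N\<close> by (simp add: frame_span_def v_def bij_betw_def)
  ultimately show ?thesis by (rule that)
qed

lemma frame_span_in_grassmannian_set:
  fixes v :: "(nat \<Rightarrow> complex) ^ 'r"
  assumes v: "v \<in> stiefel_set"
  shows "frame_span v \<in> grassmannian_set TYPE('r)"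
proof -
  \<comment> \<open>Injectivity lets sums over the set of frame vectors be read as sums over
    indices, and gives this set \<open>CARD('r)\<close> elements.\<close>
  have inj: "inj (\<lambda>i. v $ i)"
  proof (rule injI)
    fix i j assume "v $ i = v $ j"
    then have "herm (v $ i) (v $ j) = herm (v $ j) (v $ j)" by simp
    with v show "i = j" by (auto simp: topspace_stiefel split: if_splits)
  qed
  have "cseq.independent (range (\<lambda>i. v $ i))"
    unfolding cseq.dependent_finite[OF finite_imageI[OF finite]]
  proof clarify
    fix u i assume u: "(\<Sum>x\<in>range (\<lambda>i. v $ i). cscale (u x) x) = 0" and "u (v $ i) \<noteq> 0"
    from u have "frame_comb v (\<chi> i. u (v $ i)) = 0"
      by (simp add: sum.reindex[OF inj] frame_comb_def)
    then have "(\<chi> i. u (v $ i)) = frame_coords v 0"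
      using frame_coords_comb[OF v] by metis
    then have "u (v $ i) = 0"
      by (simp add: vec_eq_iff frame_coords_def herm_def)
    with \<open>u (v $ i) \<noteq> 0\<close> show False ..
  qed
  then have "cseq.dim (frame_span v) = CARD('r)"
    by (simp add: frame_span_def cseq.dim_eq_card_independent card_image[OF inj])
  moreover have "frame_span v \<subseteq> finseq"
    using frame_comb_in_finseq[OF v] by (auto simp: frame_span_eq_range)
  ultimately show ?thesis
    by (simp add: grassmannian_set_def subspace_frame_span topspace_C_infinity)
qed

lemma frame_span_image: "frame_span ` (stiefel_set :: ((nat \<Rightarrow> complex) ^ 'r) set) = grassmannian_set TYPE('r)"
proof
  show "grassmannian_set TYPE('r) \<subseteq> frame_span ` (stiefel_set :: ((nat \<Rightarrow> complex) ^ 'r) set)"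
    by (rule subsetI, erule frame_exists) blast
qed (auto simp: frame_span_in_grassmannian_set)

lemma topspace_grassmannian: "topspace (grassmannian TYPE('r::finite)) = grassmannian_set TYPE('r)"
  unfolding grassmannian_def by (rule topspace_quotient_topology) (simp add: frame_span_image)

lemma quotient_map_frame_span:
  "quotient_map (stiefel :: ((nat \<Rightarrow> complex) ^ 'r) topology) (grassmannian TYPE('r)) frame_span"
  unfolding quotient_map_def topspace_grassmannian frame_span_image
  by (simp add: grassmannian_def openin_quotient_topology)

lemmas continuous_map_frame_span = quotient_imp_continuous_map[OF quotient_map_frame_span]

lemma continuous_map_frame_mult_right:
  assumes "a \<in> unitary_group"
  shows "continuous_map stiefel stiefel (\<lambda>v. frame_mult v a)"
  using assms by (intro continuous_map_frame_mult_compose) auto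

text \<open>The matrix is \<open>frame_change v w\<close>. The fibres of \<open>frame_span\<close>
  are thus the orbits of the unitary group, a fact behind openness, local sections and the
  description of the associated classes.\<close>

lemma frame_span_eq_iff:
  assumes "v \<in> stiefel_set" "w \<in> stiefel_set"
  shows "frame_span v = frame_span w \<longleftrightarrow> (\<exists>a\<in>unitary_group. w = frame_mult v a)"
proof
  assume eq: "frame_span v = frame_span w"
  then have "frame_mult v (frame_change v w) = w"
    using frame_mult_change[OF assms(1)] frame_in_span by metis
  then show "\<exists>a\<in>unitary_group. w = frame_mult v a"
    using frame_change_unitary[OF assms eq] by metis
qed (auto simp: frame_span_mult)

lemma open_map_frame_span:
  "open_map (stiefel :: ((nat \<Rightarrow> complex) ^ 'r) topology) (grassmannian TYPE('r)) frame_span"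
  unfolding open_map_def
proof (intro allI impI)
  fix S :: "((nat \<Rightarrow> complex) ^ 'r) set"
  assume S: "openin stiefel S"
  then have sub: "S \<subseteq> stiefel_set" by (rule openin_subset)
  let ?T = "{v :: (nat \<Rightarrow> complex) ^ 'r. v \<in> stiefel_set \<and> frame_span v \<in> frame_span ` S}"
  \<comment> \<open>The saturation of \<open>S\<close> is the union of its translates, each of which
    is the preimage of \<open>S\<close> under a continuous multiplication.\<close>
  have eq: "?T
      = (\<Union>a\<in>unitary_group. {v \<in> stiefel_set. frame_mult v a \<in> S})"
  proof (intro set_eqI iffI)
    fix v :: "(nat \<Rightarrow> complex) ^ 'r" assume "v \<in> ?T"
    then obtain w where "v \<in> stiefel_set" "w \<in> S" "frame_span v = frame_span w" by blast
    moreover from this obtain a where "a \<in> unitary_group" "w = frame_mult v a"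
      using sub frame_span_eq_iff[of v w] by blast
    ultimately show "v \<in> (\<Union>a\<in>unitary_group. {v \<in> stiefel_set. frame_mult v a \<in> S})" by blast
  next
    fix v :: "(nat \<Rightarrow> complex) ^ 'r" assume "v \<in> (\<Union>a\<in>unitary_group. {v \<in> stiefel_set. frame_mult v a \<in> S})"
    then obtain a where "v \<in> stiefel_set" "a \<in> unitary_group" "frame_mult v a \<in> S" by blast
    moreover from this have "frame_span v = frame_span (frame_mult v a)" by (simp add: frame_span_mult)
    ultimately show "v \<in> ?T" by blast
  qed
  have "openin stiefel {v \<in> stiefel_set. frame_mult v a \<in> S}" if "a \<in> unitary_group" for a
    using continuous_map_frame_mult_right[OF that] S by (rule openin_continuous_map_preimage)
  then have "openin stiefel ?T"
    unfolding eq by (intro openin_Union) blast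
  moreover have "frame_span ` S \<subseteq> topspace (grassmannian TYPE('r))"
    using sub by (auto simp: topspace_grassmannian frame_span_in_grassmannian_set)
  ultimately show "openin (grassmannian TYPE('r)) (frame_span ` S)"
    using quotient_map_frame_span[where 'r = 'r] unfolding quotient_map_def by blast
qed

lemma conj_transpose_mult: "conj_transpose (a ** b) = conj_transpose b ** conj_transpose a"
  by (simp add: vec_eq_iff conj_transpose_def matrix_matrix_mult_def mult.commute)

lemma continuous_map_conj_transpose:
  "continuous_map X euclidean f \<Longrightarrow> continuous_map X euclidean (\<lambda>x. conj_transpose (f x))"
  unfolding conj_transpose_def
  by (intro continuous_map_vec_lambda continuous_map_cnj continuous_map_vec_nth)

lemma local_section:
  assumes "N0 \<in> topspace (grassmannian TYPE('r::finite))"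
  obtains U and \<sigma> :: "_ \<Rightarrow> (nat \<Rightarrow> complex) ^ 'r"
  where "openin (grassmannian TYPE('r)) U" "N0 \<in> U"
    "continuous_map (subtopology (grassmannian TYPE('r)) U) stiefel \<sigma>"
    "\<And>N. N \<in> U \<Longrightarrow> frame_span (\<sigma> N) = N"
proof -
  obtain v0 :: "(nat \<Rightarrow> complex) ^ 'r" where v0: "v0 \<in> stiefel_set" "frame_span v0 = N0"
    using frame_exists assms unfolding topspace_grassmannian by blast
  obtain W :: "(complex ^ 'r ^ 'r) set" and q where W: "open W" "mat 1 \<in> W"
    and q: "continuous_on W q" "\<And>a. a \<in> W \<Longrightarrow> q a \<in> unitary_group"
    and equi: "\<And>a u. a \<in> W \<Longrightarrow> u \<in> unitary_group \<Longrightarrow> a ** u \<in> W \<and> q (a ** u) = q a ** u"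
    using unitary_retraction by blast
  let ?A = "frame_change v0"
  define P where "P = {v \<in> stiefel_set. ?A v \<in> W}"
  \<comment> \<open>The columns of \<open>conj_transpose (?A v)\<close> are the coordinates, in
    \<open>v\<close>, of the projections of the members of \<open>v0\<close> to the span of
    \<open>v\<close>. Applying \<open>q\<close> orthonormalises them, up to conjugation, so
    \<open>s v\<close> is the orthonormalised projection of \<open>v0\<close>.\<close>
  define s where "s v = frame_mult v (conj_transpose (q (?A v)))" for v
  define U where "U = frame_span ` P"
  define \<sigma> where "\<sigma> N = s (SOME v. v \<in> P \<and> frame_span v = N)" for N
  have contA: "continuous_map stiefel euclidean ?A"
    by (intro continuous_map_frame_change) (use v0 in auto)
  have P: "openin stiefel P"
    unfolding P_def using contA W(1) by (intro openin_continuous_map_preimage) auto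
  \<comment> \<open>Passing from \<open>v\<close> to \<open>v a\<close> replaces
    \<open>q (?A v)\<close> by \<open>q (?A v) ** a\<close>; its adjoint contributes the adjoint of
    \<open>a\<close> on the left, which cancels the new factor. So the frame chosen in the
    definition of \<open>\<sigma>\<close> does not matter.\<close>
  have PP: "frame_mult v a \<in> P \<and> s (frame_mult v a) = s v" if "v \<in> P" "a \<in> unitary_group" for v a
  proof -
    have v: "v \<in> stiefel_set" and Av: "?A v \<in> W" using that by (auto simp: P_def)
    have eq: "?A (frame_mult v a) = ?A v ** a" by (rule frame_change_mult_right[OF v])
    have "frame_mult v a \<in> P"
      using equi[OF Av that(2)] frame_mult_in_stiefel[OF v that(2)] by (simp add: P_def eq)
    moreover have "a ** (conj_transpose a ** b) = b" for b :: "complex ^ 'r ^ 'r"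
      using that(2) by (simp add: unitary_group_def matrix_mul_assoc)
    then have "s (frame_mult v a) = s v"
      using equi[OF Av that(2)] by (simp add: s_def eq conj_transpose_mult flip: frame_mult_mult)
    ultimately show ?thesis ..
  qed
  have same: "w \<in> P \<and> s w = s v" if "v \<in> P" "w \<in> stiefel_set" "frame_span v = frame_span w" for v w
    using that frame_span_eq_iff[of v w] PP[OF that(1)] by (auto simp: P_def)
  have sig: "\<sigma> (frame_span v) = s v" if "v \<in> P" for v
  proof -
    have "\<exists>w. w \<in> P \<and> frame_span w = frame_span v" using that by blast
    from someI_ex[OF this] show ?thesis
      unfolding \<sigma>_def using same[OF that, of "SOME w. w \<in> P \<and> frame_span w = frame_span v"]
      by (auto simp: P_def)
  qed
  have U: "openin (grassmannian TYPE('r)) U"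
    using open_map_frame_span P unfolding U_def open_map_def by blast
  \<comment> \<open>Since \<open>P\<close> is a union of orbits, \<open>frame_span\<close> restricts
    to a quotient map from \<open>P\<close> to \<open>U\<close>, along which the continuity of
    \<open>s\<close> descends to \<open>\<sigma>\<close>.\<close>
  have sat: "{v \<in> stiefel_set. frame_span v \<in> U} = P"
  proof
    show "P \<subseteq> {v \<in> stiefel_set. frame_span v \<in> U}" by (auto simp: U_def P_def)
    show "{v \<in> stiefel_set. frame_span v \<in> U} \<subseteq> P" using same by (auto simp: U_def)
  qed
  have "continuous_map (subtopology (grassmannian TYPE('r)) U) stiefel \<sigma>"
  proof (rule continuous_compose_quotient_map)
    show "quotient_map (subtopology stiefel P) (subtopology (grassmannian TYPE('r)) U) frame_span"
      by (intro quotient_map_restriction quotient_map_frame_span sat disjI1 U)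
    have "continuous_map (subtopology stiefel P) (top_of_set W) ?A"
      using contA by (intro continuous_map_into_subtopology continuous_map_from_subtopology) (auto simp: P_def)
    then have "continuous_map (subtopology stiefel P) euclidean (q \<circ> ?A)"
      using q(1) by (intro continuous_map_compose) auto
    then have "continuous_map (subtopology stiefel P) stiefel s"
      unfolding s_def
      by (intro continuous_map_frame_mult_compose continuous_map_conj_transpose conj_transpose_unitary q(2))
        (auto simp: o_def P_def)
    then show "continuous_map (subtopology stiefel P) stiefel (\<sigma> \<circ> frame_span)"
      by (rule continuous_map_eq) (simp add: sig)
  qed
  moreover have "frame_span (\<sigma> N) = N" if "N \<in> U" for N
    using that by (auto simp: U_def P_def sig s_def frame_span_mult conj_transpose_unitary q(2))
  moreover have "N0 \<in> U"
    using v0 W(2) by (auto simp: U_def P_def frame_change_self)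
  ultimately show ?thesis using that U by blast
qed

section \<open>The Stiefel bundle and the canonical bundle\<close>

lemma module_act_frame_comb:
  "frame_comb (stiefel_act \<gamma> (mat 1) v) y = module_act \<gamma> (frame_comb v y)"
  by (simp add: stiefel_act_mat_1 fun_eq_iff frame_comb_apply module_act_def sum_distrib_left mult_ac)

lemma module_act_frame_span:
  "module_act \<gamma> ` frame_span v = frame_span (stiefel_act \<gamma> (mat 1) v)"
  by (simp add: frame_span_eq_range module_act_frame_comb image_image)

lemma stiefel_act_frame_mult:
  "stiefel_act \<gamma> (mat 1) (frame_mult v a) = frame_mult (stiefel_act \<gamma> (mat 1) v) a"
  by (simp add: frame_mult_def module_act_frame_comb) (simp add: stiefel_act_mat_1)

lemma module_act_1: "module_act 1 z = z"
  by (simp add: module_act_def)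

lemma module_act_mult: "module_act (\<gamma> * \<delta>) z = module_act \<gamma> (module_act \<delta> z)"
  by (simp add: module_act_def fun_eq_iff power_mult_distrib mult_ac)

lemma module_act_add: "module_act \<gamma> (x + y) = module_act \<gamma> x + module_act \<gamma> y"
  by (simp add: module_act_def fun_eq_iff distrib_left)

lemma module_act_cscale: "module_act \<gamma> (cscale c x) = cscale c (module_act \<gamma> x)"
  by (simp add: module_act_def fun_eq_iff cscale_def mult_ac)

section \<open>The Stiefel bundle as an equivariant principal bundle\<close>

lemma cyclic_space_stiefel:
  assumes "n \<ge> 1"
  shows "cyclic_space n (stiefel :: ((nat \<Rightarrow> complex) ^ 'r) topology) (\<lambda>\<gamma>. stiefel_act \<gamma> (mat 1))"
  unfolding cyclic_space_def
proof (intro conjI ballI)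
  show "continuous_map stiefel stiefel (stiefel_act \<gamma> (mat 1) :: (nat \<Rightarrow> complex) ^ 'r \<Rightarrow> _)"
    if "\<gamma> \<in> cyclic_roots n" for \<gamma>
    using that by (intro continuous_map_stiefel_act cyclic_roots_cnj[OF assms])
qed (simp_all add: stiefel_act_mat_1 module_act_1 module_act_mult)

text \<open>The action on subspaces is covered by the continuous action on frames, and continuity
  out of a quotient is tested before passing to the quotient.\<close>

lemma continuous_map_grassmannian_act:
  assumes "\<gamma> * cnj \<gamma> = 1"
  shows "continuous_map (grassmannian TYPE('r::finite)) (grassmannian TYPE('r)) ((`) (module_act \<gamma>))"
proof (rule continuous_compose_quotient_map[OF quotient_map_frame_span])
  have "continuous_map (stiefel :: ((nat \<Rightarrow> complex) ^ 'r) topology) (grassmannian TYPE('r))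
      (frame_span \<circ> stiefel_act \<gamma> (mat 1))"
    by (rule continuous_map_compose[OF continuous_map_stiefel_act[OF assms] continuous_map_frame_span])
  then show "continuous_map (stiefel :: ((nat \<Rightarrow> complex) ^ 'r) topology) (grassmannian TYPE('r))
      ((`) (module_act \<gamma>) \<circ> frame_span)"
    by (simp add: o_def module_act_frame_span)
qed

lemma cyclic_space_grassmannian:
  assumes "n \<ge> 1"
  shows "cyclic_space n (grassmannian TYPE('r::finite)) (\<lambda>\<gamma> N. module_act \<gamma> ` N)"
  unfolding cyclic_space_def
  using continuous_map_grassmannian_act[OF cyclic_roots_cnj[OF assms]]
  by (auto simp: module_act_1 module_act_mult image_image)

text \<open>A local section \<open>\<sigma>\<close> gives the chart: a frame \<open>v\<close> of
  \<open>N\<close> is written uniquely as \<open>\<sigma> N\<close> times a unitary matrix, namely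
  \<open>frame_change (\<sigma> N) v\<close>, and the inverse multiplies \<open>\<sigma> N\<close>
  by the matrix.\<close>

lemma stiefel_local_triviality:
  assumes "N0 \<in> topspace (grassmannian TYPE('r::finite))"
  shows "\<exists>U \<phi>. openin (grassmannian TYPE('r)) U \<and> N0 \<in> U \<and>
    homeomorphic_map (subtopology (stiefel :: ((nat \<Rightarrow> complex) ^ 'r) topology) {v \<in> stiefel_set. frame_span v \<in> U})
      (prod_topology (subtopology (grassmannian TYPE('r)) U) (top_of_set unitary_group)) \<phi> \<and>
    (\<forall>v\<in>stiefel_set. frame_span v \<in> U \<longrightarrow> fst (\<phi> v) = frame_span v \<and>
       (\<forall>a\<in>unitary_group. \<phi> (frame_mult v a) = (frame_span v, snd (\<phi> v) ** a)))"
proof -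
  obtain U and \<sigma> :: "_ \<Rightarrow> (nat \<Rightarrow> complex) ^ 'r" where U: "openin (grassmannian TYPE('r)) U" "N0 \<in> U"
    and cont: "continuous_map (subtopology (grassmannian TYPE('r)) U) stiefel \<sigma>"
    and sec: "\<And>N. N \<in> U \<Longrightarrow> frame_span (\<sigma> N) = N"
    using local_section[OF assms] by blast
  have UG: "U \<subseteq> topspace (grassmannian TYPE('r))" using U(1) by (rule openin_subset)
  then have sigma: "\<sigma> N \<in> stiefel_set" if "N \<in> U" for N
    using continuous_map_image_subset_topspace[OF cont] that by auto
  let ?X = "subtopology (stiefel :: ((nat \<Rightarrow> complex) ^ 'r) topology) {v \<in> stiefel_set. frame_span v \<in> U}"
  let ?G = "subtopology (grassmannian TYPE('r)) U"
  let ?Y = "prod_topology ?G (top_of_set unitary_group)"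
  define \<phi> where "\<phi> v = (frame_span v, frame_change (\<sigma> (frame_span v)) v)" for v :: "(nat \<Rightarrow> complex) ^ 'r"
  define \<psi> where "\<psi> = (\<lambda>(N, a). frame_mult (\<sigma> N) a)"
  have id: "continuous_map ?X stiefel (\<lambda>v. v)" by simp
  have span: "continuous_map ?X ?G frame_span"
    by (intro continuous_map_into_subtopology continuous_map_from_subtopology continuous_map_frame_span) auto
  have change: "frame_change (\<sigma> (frame_span v)) v \<in> unitary_group" if "v \<in> stiefel_set" "frame_span v \<in> U" for v
    using that by (intro frame_change_unitary sigma) (auto simp: sec)
  have "continuous_map ?X euclidean (\<lambda>v. frame_change (\<sigma> (frame_span v)) v)"
    using continuous_map_compose[OF span cont] by (intro continuous_map_frame_change id) (simp add: o_def)
  then have "continuous_map ?X ?Y \<phi>"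
    unfolding \<phi>_def using change
    by (intro continuous_map_pairedI[OF span] continuous_map_into_subtopology) auto
  moreover have "continuous_map ?Y ?X \<psi>"
  proof (rule continuous_map_into_subtopology)
    show "continuous_map ?Y stiefel \<psi>"
      unfolding \<psi>_def case_prod_unfold
    proof (rule continuous_map_frame_mult_compose)
      show "continuous_map ?Y stiefel (\<lambda>p. \<sigma> (fst p))"
        using continuous_map_compose[OF continuous_map_fst cont] by (simp add: o_def)
    qed (auto simp: continuous_map_snd_top_of_set)
    show "\<psi> \<in> topspace ?Y \<rightarrow> {v \<in> stiefel_set. frame_span v \<in> U}"
      by (auto simp: \<psi>_def frame_mult_in_stiefel sigma frame_span_mult sec)
  qed
  moreover have "\<psi> (\<phi> v) = v" if "v \<in> topspace ?X" for v
  proof -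
    have "v \<in> stiefel_set" "frame_span v \<in> U" using that by auto
    then show ?thesis
      using frame_mult_change[OF sigma, of "frame_span v" v] by (simp add: \<phi>_def \<psi>_def sec frame_in_span)
  qed
  moreover have "\<phi> (\<psi> p) = p" if "p \<in> topspace ?Y" for p
    using that by (auto simp: \<phi>_def \<psi>_def frame_span_mult sec frame_change_mult sigma)
  ultimately have "homeomorphic_maps ?X ?Y \<phi> \<psi>"
    by (auto simp: homeomorphic_maps_def)
  then have "homeomorphic_map ?X ?Y \<phi>" by (rule homeomorphic_maps_imp_map)
  moreover have "\<forall>v\<in>stiefel_set. frame_span v \<in> U \<longrightarrow> fst (\<phi> v) = frame_span v \<and>
       (\<forall>a\<in>unitary_group. \<phi> (frame_mult v a) = (frame_span v, snd (\<phi> v) ** a))"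
    by (simp add: \<phi>_def frame_span_mult frame_change_mult_right)
  ultimately show ?thesis using U by blast
qed

text \<open>Replaces \<open>frame_mult\<close> by the formula with \<open>matrix_inv\<close>; the
  two agree on the unitary group but not on all matrices.\<close>

lemma continuous_map_prod_cong:
  assumes "continuous_map (prod_topology X (top_of_set A)) Z (\<lambda>(x, a). f x a)" "\<And>x a. a \<in> A \<Longrightarrow> f x a = g x a"
  shows "continuous_map (prod_topology X (top_of_set A)) Z (\<lambda>(x, a). g x a)"
  by (rule continuous_map_eq[OF assms(1)]) (auto simp: assms(2))

lemma unitary_mult:
  assumes "a \<in> unitary_group" "b \<in> unitary_group"
  shows "a ** b \<in> unitary_group"
proof -
  have "conj_transpose (a ** b) ** (a ** b) = conj_transpose b ** (conj_transpose a ** a) ** b"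
    by (simp add: conj_transpose_mult matrix_mul_assoc)
  then have "conj_transpose (a ** b) ** (a ** b) = mat 1"
    using assms by (simp add: unitary_group_def)
  then show ?thesis using matrix_left_right_inverse by (auto simp: unitary_group_def)
qed

lemma principal_unitary_bundle_stiefel:
  "principal_unitary_bundle (stiefel_bundle :: ((nat \<Rightarrow> complex) ^ 'r, _, 'r::finite) principal_data)"
proof -
  have mult: "\<forall>v\<in>stiefel_set. \<forall>a\<in>unitary_group. \<forall>b\<in>unitary_group.
      stiefel_act 1 (matrix_inv (a ** b)) v
        = stiefel_act 1 (matrix_inv b) (stiefel_act 1 (matrix_inv a) (v :: (nat \<Rightarrow> complex) ^ 'r))"
  proof (intro ballI)
    fix v :: "(nat \<Rightarrow> complex) ^ 'r" and a b :: "complex ^ 'r ^ 'r"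
    assume ab: "a \<in> unitary_group" "b \<in> unitary_group"
    then have "a ** b \<in> unitary_group" by (rule unitary_mult)
    with ab show "stiefel_act 1 (matrix_inv (a ** b)) v
        = stiefel_act 1 (matrix_inv b) (stiefel_act 1 (matrix_inv a) v)"
      by (simp add: stiefel_act_inv frame_mult_mult)
  qed
  have loc: "\<exists>U \<phi>. openin (grassmannian TYPE('r)) U \<and> N0 \<in> U \<and>
    homeomorphic_map (subtopology (stiefel :: ((nat \<Rightarrow> complex) ^ 'r) topology) {v \<in> stiefel_set. frame_span v \<in> U})
      (prod_topology (subtopology (grassmannian TYPE('r)) U) (top_of_set unitary_group)) \<phi> \<and>
    (\<forall>v\<in>stiefel_set. frame_span v \<in> U \<longrightarrow> fst (\<phi> v) = frame_span v \<and>
       (\<forall>a\<in>unitary_group. \<phi> (stiefel_act 1 (matrix_inv a) v) = (frame_span v, snd (\<phi> v) ** a)))"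
    if "N0 \<in> topspace (grassmannian TYPE('r))" for N0
    using stiefel_local_triviality[OF that] by (simp add: stiefel_act_inv)
  have "continuous_map (prod_topology (stiefel :: ((nat \<Rightarrow> complex) ^ 'r) topology) (top_of_set unitary_group)) stiefel
      (\<lambda>(p, a). stiefel_act 1 (matrix_inv a) p)"
    by (rule continuous_map_prod_cong[OF continuous_map_frame_mult]) (simp add: stiefel_act_inv)
  then show ?thesis
    unfolding principal_unitary_bundle_def stiefel_bundle_def principal_data.simps
    using mult loc
    by (auto simp: continuous_map_frame_span stiefel_act_inv mat_1_unitary frame_mult_1 frame_span_mult
        simp del: split_paired_Ex)
qed

lemma cyclic_principal_bundle_stiefel:
  assumes "n \<ge> 1"
  shows "cyclic_principal_bundle n (stiefel_bundle :: ((nat \<Rightarrow> complex) ^ 'r, _, 'r::finite) principal_data)"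
  unfolding cyclic_principal_bundle_def
  using principal_unitary_bundle_stiefel cyclic_space_stiefel[OF assms] cyclic_space_grassmannian[OF assms]
  by (simp add: stiefel_bundle_def module_act_frame_span stiefel_act_inv stiefel_act_frame_mult)

section \<open>The canonical bundle as an equivariant vector bundle\<close>

abbreviation canonical_space :: "'r::finite itself \<Rightarrow> ((nat \<Rightarrow> complex) set \<times> (nat \<Rightarrow> complex)) topology" where
  "canonical_space R \<equiv> subtopology (prod_topology (grassmannian R) C_infinity) {(N, z). z \<in> N}"

lemma topspace_canonical_space:
  "topspace (canonical_space TYPE('r::finite)) = {(N, z). N \<in> grassmannian_set TYPE('r) \<and> z \<in> N}"
  by (auto simp: topspace_grassmannian grassmannian_set_def)

lemma canonical_fibre:
  assumes "N \<in> topspace (grassmannian TYPE('r::finite))"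
  shows "vb_fibre (canonical_bundle TYPE('r)) N = {N} \<times> N"
  using assms unfolding vb_fibre_def canonical_bundle_def vb_data.simps topspace_canonical_space
  by (auto simp: topspace_grassmannian)

lemma frame_coords_add:
  "x \<in> finseq \<Longrightarrow> y \<in> finseq \<Longrightarrow> frame_coords v (x + y) = frame_coords v x + frame_coords v y"
  by (simp add: frame_coords_def herm_add_left vec_eq_iff)

lemma frame_coords_cscale: "x \<in> finseq \<Longrightarrow> frame_coords v (cscale c x) = c *s frame_coords v x"
  by (simp add: frame_coords_def herm_cscale_left vec_eq_iff)

text \<open>The chart takes coordinates in the frame \<open>\<sigma> N\<close> of a local section.
  Both the frame and the vector vary, so its continuity depends on the joint continuity of the inner
  product.\<close>

lemma canonical_local_triviality:
  assumes "N0 \<in> topspace (grassmannian TYPE('r::finite))"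
  shows "\<exists>U (\<phi> :: _ \<Rightarrow> _ \<times> (complex ^ 'r)). openin (grassmannian TYPE('r)) U \<and> N0 \<in> U \<and>
    homeomorphic_map
      (subtopology (canonical_space TYPE('r)) {x \<in> topspace (canonical_space TYPE('r)). fst x \<in> U})
      (prod_topology (subtopology (grassmannian TYPE('r)) U) euclidean) \<phi> \<and>
    (\<forall>N\<in>U. \<forall>z\<in>N. fst (\<phi> (N, z)) = N \<and>
       (\<forall>z'\<in>N. snd (\<phi> (N, z + z')) = snd (\<phi> (N, z)) + snd (\<phi> (N, z'))) \<and>
       (\<forall>c. snd (\<phi> (N, cscale c z)) = c *s snd (\<phi> (N, z))))"
proof -
  obtain U and \<sigma> :: "_ \<Rightarrow> (nat \<Rightarrow> complex) ^ 'r" where U: "openin (grassmannian TYPE('r)) U" "N0 \<in> U"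
    and cont: "continuous_map (subtopology (grassmannian TYPE('r)) U) stiefel \<sigma>"
    and sec: "\<And>N. N \<in> U \<Longrightarrow> frame_span (\<sigma> N) = N"
    using local_section[OF assms] by blast
  have UG: "U \<subseteq> topspace (grassmannian TYPE('r))" using U(1) by (rule openin_subset)
  then have sigma: "\<sigma> N \<in> stiefel_set" if "N \<in> U" for N
    using continuous_map_image_subset_topspace[OF cont] that by auto
  have fin: "z \<in> finseq" if "N \<in> U" "z \<in> N" for N z
    using UG that by (auto simp: topspace_grassmannian grassmannian_set_def topspace_C_infinity)
  let ?G = "subtopology (grassmannian TYPE('r)) U"
  let ?X = "subtopology (canonical_space TYPE('r)) {x \<in> topspace (canonical_space TYPE('r)). fst x \<in> U}"
  let ?Y = "prod_topology ?G (euclidean :: (complex ^ 'r) topology)"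
  define \<phi> where "\<phi> p = (fst p, frame_coords (\<sigma> (fst p)) (snd p))" for p
  define \<psi> where "\<psi> p = (fst p, frame_comb (\<sigma> (fst p)) (snd p))" for p :: "_ \<times> (complex ^ 'r)"
  have X: "topspace ?X = {(N, z). N \<in> U \<and> z \<in> N}"
    using UG unfolding topspace_subtopology[of "canonical_space TYPE('r)"] topspace_canonical_space
    by (auto simp: topspace_grassmannian)
  have f: "continuous_map ?X ?G fst"
    by (intro continuous_map_into_subtopology continuous_map_from_subtopology continuous_map_fst) auto
  have "continuous_map ?X C_infinity snd"
    by (intro continuous_map_from_subtopology continuous_map_snd)
  then have "continuous_map ?X euclidean (\<lambda>p. frame_coords (\<sigma> (fst p)) (snd p))"
    using continuous_map_compose[OF f cont] by (intro continuous_map_frame_coords) (auto simp: o_def)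
  then have "continuous_map ?X ?Y \<phi>"
    unfolding \<phi>_def by (intro continuous_map_pairedI f)
  moreover have "continuous_map ?Y ?X \<psi>"
  proof -
    have f': "continuous_map ?Y ?G fst" by (rule continuous_map_fst)
    have "continuous_map ?Y (grassmannian TYPE('r)) fst"
      by (rule continuous_map_into_fulltopology[OF f'])
    moreover have "continuous_map ?Y C_infinity (\<lambda>p. frame_comb (\<sigma> (fst p)) (snd p))"
      using continuous_map_compose[OF f' cont]
      by (intro continuous_map_frame_comb_compose continuous_map_snd) (simp add: o_def)
    ultimately have c: "continuous_map ?Y (prod_topology (grassmannian TYPE('r)) C_infinity) \<psi>"
      unfolding \<psi>_def by (rule continuous_map_pairedI)
    have "frame_comb (\<sigma> N) y \<in> N" if "N \<in> U" for N y
      using frame_comb_in_span[of "\<sigma> N" y] sec[OF that] by simp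
    then have "\<psi> p \<in> topspace ?X" if "p \<in> topspace ?Y" for p
      using that unfolding X by (auto simp: \<psi>_def)
    then show ?thesis
      using c unfolding subtopology_subtopology by (intro continuous_map_into_subtopology) auto
  qed
  moreover have "\<psi> (\<phi> p) = p" if "p \<in> topspace ?X" for p
    using that unfolding X by (auto simp: \<phi>_def \<psi>_def frame_comb_coords sigma sec)
  moreover have "\<phi> (\<psi> p) = p" if "p \<in> topspace ?Y" for p
    using that by (auto simp: \<phi>_def \<psi>_def frame_coords_comb sigma)
  ultimately have "homeomorphic_maps ?X ?Y \<phi> \<psi>"
    unfolding homeomorphic_maps_def by blast
  then have "homeomorphic_map ?X ?Y \<phi>" by (rule homeomorphic_maps_imp_map)
  moreover have "\<forall>N\<in>U. \<forall>z\<in>N. fst (\<phi> (N, z)) = N \<and>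
       (\<forall>z'\<in>N. snd (\<phi> (N, z + z')) = snd (\<phi> (N, z)) + snd (\<phi> (N, z'))) \<and>
       (\<forall>c. snd (\<phi> (N, cscale c z)) = c *s snd (\<phi> (N, z)))"
    using fin by (auto simp: \<phi>_def frame_coords_add frame_coords_cscale)
  ultimately show ?thesis using U by blast
qed

lemma subspace_grassmannian:
  assumes "N \<in> topspace (grassmannian TYPE('r::finite))"
  shows "cseq.subspace N"
  using assms by (simp add: topspace_grassmannian grassmannian_set_def)

lemma vector_bundle_canonical: "vector_bundle TYPE('r::finite) (canonical_bundle TYPE('r))"
  unfolding vector_bundle_def
proof (intro conjI ballI)
  show "continuous_map (vb_total (canonical_bundle TYPE('r))) (vb_base (canonical_bundle TYPE('r)))
      (vb_proj (canonical_bundle TYPE('r)))"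
    by (simp add: canonical_bundle_def continuous_map_from_subtopology continuous_map_fst)
next
  fix N assume "N \<in> topspace (vb_base (canonical_bundle TYPE('r)))"
  then have N: "N \<in> topspace (grassmannian TYPE('r))" by (simp add: canonical_bundle_def)
  note sub = subspace_grassmannian[OF N]
  show "vb_add (canonical_bundle TYPE('r)) x y \<in> vb_fibre (canonical_bundle TYPE('r)) N"
    if "x \<in> vb_fibre (canonical_bundle TYPE('r)) N" "y \<in> vb_fibre (canonical_bundle TYPE('r)) N" for x y
    using that sub unfolding canonical_fibre[OF N]
    by (auto simp: canonical_bundle_def cseq.subspace_def)
  show "\<forall>c. \<forall>x\<in>vb_fibre (canonical_bundle TYPE('r)) N.
      vb_scale (canonical_bundle TYPE('r)) c x \<in> vb_fibre (canonical_bundle TYPE('r)) N"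
    using sub unfolding canonical_fibre[OF N]
    by (auto simp: canonical_bundle_def cseq.subspace_def)
  obtain U and \<phi> :: "_ \<Rightarrow> _ \<times> (complex ^ 'r)" where U: "openin (grassmannian TYPE('r)) U" "N \<in> U"
    and phi: "homeomorphic_map
      (subtopology (canonical_space TYPE('r)) {x \<in> topspace (canonical_space TYPE('r)). fst x \<in> U})
      (prod_topology (subtopology (grassmannian TYPE('r)) U) euclidean) \<phi>"
    and lin: "\<forall>N\<in>U. \<forall>z\<in>N. fst (\<phi> (N, z)) = N \<and>
       (\<forall>z'\<in>N. snd (\<phi> (N, z + z')) = snd (\<phi> (N, z)) + snd (\<phi> (N, z'))) \<and>
       (\<forall>c. snd (\<phi> (N, cscale c z)) = c *s snd (\<phi> (N, z)))"
    using canonical_local_triviality[OF N] by (elim exE conjE) (rule that)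
  have UG: "u \<in> topspace (grassmannian TYPE('r))" if "u \<in> U" for u
    using openin_subset[OF U(1)] that by blast
  have "\<forall>u\<in>U. \<forall>x\<in>vb_fibre (canonical_bundle TYPE('r)) u. fst (\<phi> x) = u \<and>
      (\<forall>y\<in>vb_fibre (canonical_bundle TYPE('r)) u.
         snd (\<phi> (vb_add (canonical_bundle TYPE('r)) x y)) = snd (\<phi> x) + snd (\<phi> y)) \<and>
      (\<forall>c. snd (\<phi> (vb_scale (canonical_bundle TYPE('r)) c x)) = c *s snd (\<phi> x))"
    using lin UG by (auto simp: canonical_fibre) (auto simp: canonical_bundle_def)
  moreover have "homeomorphic_map
      (subtopology (vb_total (canonical_bundle TYPE('r)))
        {x \<in> topspace (vb_total (canonical_bundle TYPE('r))). vb_proj (canonical_bundle TYPE('r)) x \<in> U})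
      (prod_topology (subtopology (vb_base (canonical_bundle TYPE('r))) U) euclidean) \<phi>"
    using phi unfolding canonical_bundle_def vb_data.simps .
  moreover have "openin (vb_base (canonical_bundle TYPE('r))) U"
    using U by (simp add: canonical_bundle_def)
  ultimately show "\<exists>U (\<phi> :: _ \<Rightarrow> _ \<times> (complex ^ 'r)). openin (vb_base (canonical_bundle TYPE('r))) U \<and> N \<in> U \<and>
      homeomorphic_map
      (subtopology (vb_total (canonical_bundle TYPE('r)))
        {x \<in> topspace (vb_total (canonical_bundle TYPE('r))). vb_proj (canonical_bundle TYPE('r)) x \<in> U})
      (prod_topology (subtopology (vb_base (canonical_bundle TYPE('r))) U) euclidean) \<phi> \<and>
      (\<forall>u\<in>U. \<forall>x\<in>vb_fibre (canonical_bundle TYPE('r)) u. fst (\<phi> x) = u \<and>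
      (\<forall>y\<in>vb_fibre (canonical_bundle TYPE('r)) u.
         snd (\<phi> (vb_add (canonical_bundle TYPE('r)) x y)) = snd (\<phi> x) + snd (\<phi> y)) \<and>
      (\<forall>c. snd (\<phi> (vb_scale (canonical_bundle TYPE('r)) c x)) = c *s snd (\<phi> x)))"
    using U(2) by (intro exI[of _ U] exI[of _ \<phi>] conjI)
qed

lemma cyclic_space_canonical:
  assumes "n \<ge> 1"
  shows "cyclic_space n (canonical_space TYPE('r::finite)) (\<lambda>\<gamma> (N, z). (module_act \<gamma> ` N, module_act \<gamma> z))"
  unfolding cyclic_space_def
proof (intro conjI ballI)
  fix \<gamma> assume "\<gamma> \<in> cyclic_roots n"
  then have \<gamma>: "\<gamma> * cnj \<gamma> = 1" using cyclic_roots_cnj assms by blast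
  have "continuous_map (canonical_space TYPE('r)) (canonical_space TYPE('r))
      (\<lambda>p. (module_act \<gamma> ` fst p, module_act \<gamma> (snd p)))"
  proof (intro continuous_map_into_subtopology continuous_map_pairedI)
    show "continuous_map (canonical_space TYPE('r)) (grassmannian TYPE('r)) (\<lambda>p. module_act \<gamma> ` fst p)"
      using continuous_map_compose[OF continuous_map_from_subtopology[OF continuous_map_fst]
          continuous_map_grassmannian_act[OF \<gamma>]] by (simp add: o_def)
    show "continuous_map (canonical_space TYPE('r)) C_infinity (\<lambda>p. module_act \<gamma> (snd p))"
      using continuous_map_compose[OF continuous_map_from_subtopology[OF continuous_map_snd]
          continuous_map_module_act] by (simp add: o_def)
  qed auto
  then show "continuous_map (canonical_space TYPE('r)) (canonical_space TYPE('r))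
      (\<lambda>(N, z). (module_act \<gamma> ` N, module_act \<gamma> z))"
    by (rule continuous_map_eq) auto
qed (auto simp: module_act_1 module_act_mult image_image)

lemma cyclic_vector_bundle_canonical:
  assumes "n \<ge> 1"
  shows "cyclic_vector_bundle n TYPE('r::finite) (canonical_bundle TYPE('r))"
proof -
  have "vb_linear_over (vb_base_act (canonical_bundle TYPE('r)) \<gamma>) (canonical_bundle TYPE('r))
      (canonical_bundle TYPE('r)) (vb_act (canonical_bundle TYPE('r)) \<gamma>)" if "\<gamma> \<in> cyclic_roots n" for \<gamma>
    unfolding vb_linear_over_def
  proof
    fix N assume "N \<in> topspace (vb_base (canonical_bundle TYPE('r)))"
    then have N: "N \<in> topspace (grassmannian TYPE('r))" by (simp add: canonical_bundle_def)
    have "continuous_map (grassmannian TYPE('r)) (grassmannian TYPE('r)) ((`) (module_act \<gamma>))"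
      using that by (intro continuous_map_grassmannian_act cyclic_roots_cnj[OF assms])
    then have "module_act \<gamma> ` N \<in> topspace (grassmannian TYPE('r))"
      using continuous_map_image_subset_topspace N by blast
    then have "vb_fibre (canonical_bundle TYPE('r)) (vb_base_act (canonical_bundle TYPE('r)) \<gamma> N)
        = {module_act \<gamma> ` N} \<times> module_act \<gamma> ` N"
      by (simp add: canonical_fibre) (simp add: canonical_bundle_def canonical_fibre[unfolded canonical_bundle_def])
    then show "\<forall>x\<in>vb_fibre (canonical_bundle TYPE('r)) N.
        vb_act (canonical_bundle TYPE('r)) \<gamma> x
          \<in> vb_fibre (canonical_bundle TYPE('r)) (vb_base_act (canonical_bundle TYPE('r)) \<gamma> N) \<and>
        (\<forall>y\<in>vb_fibre (canonical_bundle TYPE('r)) N.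
          vb_act (canonical_bundle TYPE('r)) \<gamma> (vb_add (canonical_bundle TYPE('r)) x y)
          = vb_add (canonical_bundle TYPE('r)) (vb_act (canonical_bundle TYPE('r)) \<gamma> x)
              (vb_act (canonical_bundle TYPE('r)) \<gamma> y)) \<and>
        (\<forall>c. vb_act (canonical_bundle TYPE('r)) \<gamma> (vb_scale (canonical_bundle TYPE('r)) c x)
          = vb_scale (canonical_bundle TYPE('r)) c (vb_act (canonical_bundle TYPE('r)) \<gamma> x))"
      unfolding canonical_fibre[OF N]
      by (auto simp: canonical_bundle_def module_act_add module_act_cscale)
  qed
  then show ?thesis
    unfolding cyclic_vector_bundle_def
    using vector_bundle_canonical cyclic_space_canonical[OF assms, where 'r = 'r]
      cyclic_space_grassmannian[OF assms, where 'r = 'r]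
    by (simp add: canonical_bundle_def)
qed

section \<open>The associated bundle as a quotient\<close>

text \<open>Two quotients of one space that identify the same points are homeomorphic: in both, a
  set is open exactly when its preimage in \<open>X\<close> is, and these preimages correspond under
  \<open>g\<close>.\<close>

lemma homeomorphic_map_quotient_topology:
  assumes q: "quotient_map X Y F" and inj: "inj_on g (topspace Y)"
    and c: "\<And>x. x \<in> topspace X \<Longrightarrow> c x = g (F x)"
  shows "homeomorphic_map Y (quotient_topology X c (g ` topspace Y)) g"
proof -
  have quot: "openin X {x \<in> topspace X. F x \<in> W} \<longleftrightarrow> openin Y W" if "W \<subseteq> topspace Y" for W
    using q that by (simp add: quotient_map_def)
  have FY: "F ` topspace X = topspace Y" using q by (simp add: quotient_map_def)
  then have top: "topspace (quotient_topology X c (g ` topspace Y)) = g ` topspace Y"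
    by (intro topspace_quotient_topology) (auto simp: c)
  have "quotient_map Y (quotient_topology X c (g ` topspace Y)) g"
    unfolding quotient_map_def top
  proof (intro conjI allI impI refl)
    fix U assume U: "U \<subseteq> g ` topspace Y"
    have "{x \<in> topspace X. c x \<in> U} = {x \<in> topspace X. F x \<in> {y \<in> topspace Y. g y \<in> U}}"
      using FY by (auto simp: c)
    moreover have "openin X {x \<in> topspace X. F x \<in> {y \<in> topspace Y. g y \<in> U}}
        \<longleftrightarrow> openin Y {y \<in> topspace Y. g y \<in> U}"
      by (rule quot) blast
    ultimately show "openin Y {x. x \<in> topspace Y \<and> g x \<in> U} \<longleftrightarrow> openin (quotient_topology X c (g ` topspace Y)) U"
      using U by (simp add: openin_quotient_topology)
  qed
  with inj show ?thesis by (simp add: homeomorphic_map_def)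
qed

text \<open>Openness survives the product with an arbitrary space, unlike the quotient property. It
  is applied with \<open>C_infinity\<close> as \<open>Z\<close>.\<close>

lemma open_map_prod_id:
  assumes "open_map X Y f"
  shows "open_map (prod_topology X Z) (prod_topology Y Z) (\<lambda>(x, z). (f x, z))"
  unfolding open_map_def
proof (intro allI impI)
  fix S assume S: "openin (prod_topology X Z) S"
  show "openin (prod_topology Y Z) ((\<lambda>(x, z). (f x, z)) ` S)"
    unfolding openin_prod_topology_alt
  proof (intro allI impI)
    fix y z assume "(y, z) \<in> (\<lambda>(x, z). (f x, z)) ` S"
    then obtain x where x: "(x, z) \<in> S" "y = f x" by auto
    from S[unfolded openin_prod_topology_alt, rule_format, OF x(1)]
    obtain U V where "openin X U" "openin Z V" "x \<in> U" "z \<in> V" "U \<times> V \<subseteq> S"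
      by blast
    moreover from this have "openin Y (f ` U)" using assms by (simp add: open_map_def)
    ultimately show "\<exists>U V. openin Y U \<and> openin Z V \<and> y \<in> U \<and> z \<in> V \<and> U \<times> V \<subseteq> (\<lambda>(x, z). (f x, z)) ` S"
      using x(2) by (intro exI[of _ "f ` U"] exI[of _ V]) auto
  qed
qed

definition frame_vector :: "((nat \<Rightarrow> complex) ^ 'r) \<times> (complex ^ 'r) \<Rightarrow> (nat \<Rightarrow> complex) set \<times> (nat \<Rightarrow> complex)" where
  "frame_vector x = (frame_span (fst x), frame_comb (fst x) (snd x))"

text \<open>Up to the homeomorphism \<open>(v, y) \<mapsto> (v, frame_comb v y)\<close> onto pairs of a frame and a vector in
  its span, the map is a restriction of \<open>frame_span \<times> id\<close>, which is open.\<close>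

lemma quotient_map_frame_vector:
  "quotient_map (prod_topology (stiefel :: ((nat \<Rightarrow> complex) ^ 'r) topology) euclidean)
     (canonical_space TYPE('r::finite)) frame_vector"
proof -
  let ?V = "stiefel :: ((nat \<Rightarrow> complex) ^ 'r) topology"
  let ?X = "prod_topology ?V (euclidean :: (complex ^ 'r) topology)"
  let ?P = "prod_topology ?V C_infinity"
  define \<pi> where "\<pi> = (\<lambda>(v :: (nat \<Rightarrow> complex) ^ 'r, z :: nat \<Rightarrow> complex). (frame_span v, z))"
  define S where "S = {p \<in> topspace ?P. \<pi> p \<in> {(N, z). z \<in> N}}"
  define h where "h x = (fst x, frame_comb (fst x) (snd x))" for x :: "((nat \<Rightarrow> complex) ^ 'r) \<times> (complex ^ 'r)"
  define k where "k x = (fst x, frame_coords (fst x) (snd x))" for x :: "((nat \<Rightarrow> complex) ^ 'r) \<times> (nat \<Rightarrow> complex)"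
  have "homeomorphic_maps ?X (subtopology ?P S) h k"
    unfolding homeomorphic_maps_def
  proof (intro conjI ballI)
    show "continuous_map ?X (subtopology ?P S) h"
    proof (rule continuous_map_into_subtopology)
      show "continuous_map ?X ?P h"
        unfolding h_def
        by (intro continuous_map_pairedI continuous_map_fst continuous_map_frame_comb_compose continuous_map_snd)
      show "h \<in> topspace ?X \<rightarrow> S"
        by (auto simp: S_def h_def \<pi>_def topspace_C_infinity frame_comb_in_finseq frame_comb_in_span)
    qed
    have f: "continuous_map (subtopology ?P S) ?V fst"
      by (intro continuous_map_from_subtopology continuous_map_fst)
    have s: "continuous_map (subtopology ?P S) C_infinity snd"
      by (intro continuous_map_from_subtopology continuous_map_snd)
    show "continuous_map (subtopology ?P S) ?X k"
      unfolding k_def by (intro continuous_map_pairedI continuous_map_frame_coords f s)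
    show "k (h x) = x" if "x \<in> topspace ?X" for x
      using that by (auto simp: k_def h_def frame_coords_comb)
    show "h (k x) = x" if "x \<in> topspace (subtopology ?P S)" for x
      using that by (auto simp: k_def h_def S_def \<pi>_def frame_comb_coords)
  qed
  then have h: "homeomorphic_map ?X (subtopology ?P S) h" by (rule homeomorphic_maps_imp_map)
  \<comment> \<open>\<open>S\<close> is the full preimage of the incidence relation under
    \<open>\<pi>\<close>, so openness passes to the restriction.\<close>
  have pi: "open_map (subtopology ?P S) (canonical_space TYPE('r)) \<pi>"
    unfolding \<pi>_def
    by (intro open_map_restriction open_map_prod_id open_map_frame_span) (simp add: S_def \<pi>_def)
  have eq: "\<pi> \<circ> h = frame_vector"
    by (auto simp: fun_eq_iff \<pi>_def h_def frame_vector_def)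
  have "open_map ?X (canonical_space TYPE('r)) frame_vector"
    using open_map_compose[OF homeomorphic_imp_open_map[OF h] pi] by (simp add: eq)
  moreover have "continuous_map ?X (canonical_space TYPE('r)) frame_vector"
  proof (rule continuous_map_into_subtopology)
    show "continuous_map ?X (prod_topology (grassmannian TYPE('r)) C_infinity) frame_vector"
      unfolding frame_vector_def
      using continuous_map_compose[OF continuous_map_fst continuous_map_frame_span]
      by (intro continuous_map_pairedI continuous_map_frame_comb_compose continuous_map_fst continuous_map_snd)
        (simp add: o_def)
  qed (auto simp: frame_vector_def frame_comb_in_span)
  moreover have "frame_vector ` topspace ?X = topspace (canonical_space TYPE('r))"
  proof (intro equalityI subsetI)
    fix p assume "p \<in> topspace (canonical_space TYPE('r))"
    then obtain N z where p: "p = (N, z)" "N \<in> grassmannian_set TYPE('r)" "z \<in> N"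
      unfolding topspace_canonical_space by auto
    obtain v :: "(nat \<Rightarrow> complex) ^ 'r" where v: "v \<in> stiefel_set" "frame_span v = N"
      using frame_exists[OF p(2)] .
    with p have "p = frame_vector (v, frame_coords v z)"
      by (simp add: frame_vector_def frame_comb_coords)
    then show "p \<in> frame_vector ` topspace ?X" using v by auto
  next
    fix p assume "p \<in> frame_vector ` topspace ?X"
    then show "p \<in> topspace (canonical_space TYPE('r))"
      unfolding topspace_canonical_space
      by (auto simp: frame_vector_def frame_span_in_grassmannian_set frame_comb_in_span)
  qed
  ultimately show ?thesis by (intro continuous_open_imp_quotient_map)
qed

text \<open>These fibres turn out to be the points of the associated bundle, so its operations on
  sets of pairs can be computed on the labels \<open>(N, z)\<close>.\<close>

definition frame_vector_fibre ::
  "(nat \<Rightarrow> complex) set \<times> (nat \<Rightarrow> complex) \<Rightarrow> (((nat \<Rightarrow> complex) ^ 'r::finite) \<times> (complex ^ 'r)) set" where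
  "frame_vector_fibre p = {x \<in> stiefel_set \<times> UNIV. frame_vector x = p}"

lemma mem_frame_vector_fibre:
  "(v, y) \<in> frame_vector_fibre (N, z) \<longleftrightarrow> v \<in> stiefel_set \<and> frame_span v = N \<and> frame_comb v y = z"
  by (auto simp: frame_vector_fibre_def frame_vector_def)

abbreviation stiefel_principal :: "((nat \<Rightarrow> complex) ^ 'r, (nat \<Rightarrow> complex) set, 'r::finite) principal_data" where
  "stiefel_principal \<equiv> stiefel_bundle"

text \<open>Frames with equal spans differ by a unitary \<open>a\<close>, say
  \<open>w = v a\<close>; uniqueness of coordinates in \<open>v\<close> then forces the second
  component to be \<open>a *v y\<close>.\<close>

lemma assoc_class:
  fixes w :: "(nat \<Rightarrow> complex) ^ 'r"
  assumes w: "w \<in> stiefel_set"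
  shows "assoc_rel stiefel_principal `` {(w, y)} = frame_vector_fibre (frame_vector (w, y))"
proof (intro set_eqI iffI)
  fix x assume "x \<in> assoc_rel stiefel_principal `` {(w, y)}"
  then obtain v a where x: "x = (v, a *v y)" "v \<in> stiefel_set" "a \<in> unitary_group"
    and w: "w = stiefel_act 1 (matrix_inv a) v"
    by (auto simp: assoc_rel_def stiefel_bundle_def)
  then have "w = frame_mult v a" by (simp add: stiefel_act_inv)
  with x show "x \<in> frame_vector_fibre (frame_vector (w, y))"
    by (simp add: frame_vector_fibre_def frame_vector_def frame_span_mult frame_comb_mult)
next
  fix x :: "((nat \<Rightarrow> complex) ^ 'r) \<times> (complex ^ 'r)"
  assume "x \<in> frame_vector_fibre (frame_vector (w, y))"
  then obtain v y' where x: "x = (v, y')" "v \<in> stiefel_set" "frame_span v = frame_span w"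
    "frame_comb v y' = frame_comb w y"
    by (auto simp: frame_vector_fibre_def frame_vector_def)
  obtain a where a: "a \<in> unitary_group" "w = frame_mult v a"
    using frame_span_eq_iff[OF x(2) w] x(3) by blast
  have "frame_comb v y' = frame_comb v (a *v y)" using x(4) a(2) by (simp add: frame_comb_mult)
  then have "y' = a *v y" using frame_coords_comb[OF x(2)] by metis
  moreover have "w = stiefel_act 1 (matrix_inv a) v"
    using a by (simp add: stiefel_act_inv)
  ultimately show "x \<in> assoc_rel stiefel_principal `` {(w, y)}"
    using x(1,2) a(1) by (auto simp: assoc_rel_def stiefel_bundle_def)
qed

lemma assoc_class_pair:
  fixes x :: "((nat \<Rightarrow> complex) ^ 'r::finite) \<times> (complex ^ 'r)"
  assumes "x \<in> stiefel_set \<times> UNIV"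
  shows "assoc_rel stiefel_principal `` {x} = frame_vector_fibre (frame_vector x)"
  using assms assoc_class[of "fst x" "snd x"] by (simp only: prod.collapse mem_Times_iff)

lemma frame_vector_fibre_nonempty:
  assumes "p \<in> topspace (canonical_space TYPE('r::finite))"
  obtains x :: "((nat \<Rightarrow> complex) ^ 'r) \<times> (complex ^ 'r)" where "x \<in> frame_vector_fibre p"
proof -
  have "p \<in> frame_vector ` (stiefel_set \<times> (UNIV :: (complex ^ 'r) set))"
    using assms quotient_imp_surjective_map[OF quotient_map_frame_vector[where 'r = 'r]] by simp
  then show ?thesis using that by (auto simp: frame_vector_fibre_def)
qed

lemma image_frame_vector_fibre:
  assumes "p \<in> topspace (canonical_space TYPE('r::finite))"
  shows "frame_vector ` (frame_vector_fibre p :: (((nat \<Rightarrow> complex) ^ 'r) \<times> (complex ^ 'r)) set) = {p}"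
  using frame_vector_fibre_nonempty[OF assms] by (auto simp: frame_vector_fibre_def)

text \<open>A fibre over a point of the canonical space is nonempty, so its image under
  \<open>frame_vector\<close> recovers the point.\<close>

lemma frame_vector_fibre_inj:
  "inj_on (frame_vector_fibre :: _ \<Rightarrow> (((nat \<Rightarrow> complex) ^ 'r) \<times> (complex ^ 'r)) set)
     (topspace (canonical_space TYPE('r::finite)))"
  by (rule inj_onI) (metis image_frame_vector_fibre the_elem_eq)

lemma assoc_quotient:
  "(stiefel_set \<times> UNIV) // assoc_rel (stiefel_principal :: (_, _, 'r) principal_data)
    = frame_vector_fibre ` topspace (canonical_space TYPE('r::finite))"
proof -
  have "(stiefel_set \<times> UNIV) // assoc_rel stiefel_principal
      = (\<lambda>x. assoc_rel stiefel_principal `` {x}) ` (stiefel_set \<times> (UNIV :: (complex ^ 'r) set))"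
    by (auto simp: quotient_def)
  also have "\<dots> = (\<lambda>x. frame_vector_fibre (frame_vector x)) ` (stiefel_set \<times> (UNIV :: (complex ^ 'r) set))"
    by (rule image_cong[OF refl assoc_class_pair])
  also have "\<dots> = frame_vector_fibre ` frame_vector ` (stiefel_set \<times> (UNIV :: (complex ^ 'r) set))"
    by (simp add: image_image)
  also have "frame_vector ` (stiefel_set \<times> (UNIV :: (complex ^ 'r) set)) = topspace (canonical_space TYPE('r))"
    using quotient_imp_surjective_map[OF quotient_map_frame_vector[where 'r = 'r]] by simp
  finally show ?thesis .
qed

abbreviation associated_space ::
  "'r::finite itself \<Rightarrow> (((nat \<Rightarrow> complex) ^ 'r) \<times> (complex ^ 'r)) set topology" where
  "associated_space R \<equiv> vb_total (associated_bundle (stiefel_bundle :: (_, _, 'r) principal_data))"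

lemma homeomorphic_map_fibre:
  "homeomorphic_map (canonical_space TYPE('r::finite)) (associated_space TYPE('r)) frame_vector_fibre"
proof -
  have "associated_space TYPE('r) = quotient_topology
      (prod_topology (stiefel :: ((nat \<Rightarrow> complex) ^ 'r) topology) (euclidean :: (complex ^ 'r) topology))
      (\<lambda>x. assoc_rel stiefel_principal `` {x}) (frame_vector_fibre ` topspace (canonical_space TYPE('r)))"
    unfolding assoc_quotient[symmetric] by (simp add: associated_bundle_def stiefel_bundle_def)
  moreover have "homeomorphic_map (canonical_space TYPE('r)) \<dots> frame_vector_fibre"
    by (intro homeomorphic_map_quotient_topology[OF quotient_map_frame_vector frame_vector_fibre_inj])
      (rule assoc_class_pair, simp)
  ultimately show ?thesis by simp
qed

section \<open>Transport of the bundle structure\<close>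

text \<open>Charts of \<open>F\<close> are composed with \<open>f\<close>, and identities in
  \<open>E\<close> are verified in \<open>F\<close> and pulled back by injectivity. It remains only
  to check that the operations of \<open>E\<close> stay in its total space and correspond to those
  of \<open>F\<close>.\<close>

lemma cyclic_vb_equivalentI:
  fixes E :: "('e, 'b) vb_data" and F :: "('f, 'b) vb_data"
  assumes F: "cyclic_vector_bundle n TYPE('r::finite) F"
    and base: "vb_base E = vb_base F" "vb_base_act E = vb_base_act F"
    and f: "homeomorphic_map (vb_total E) (vb_total F) f"
    and proj: "\<And>x. x \<in> topspace (vb_total E) \<Longrightarrow> vb_proj F (f x) = vb_proj E x"
    and add: "\<And>x y. x \<in> topspace (vb_total E) \<Longrightarrow> y \<in> topspace (vb_total E) \<Longrightarrow> vb_proj E x = vb_proj E y \<Longrightarrow>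
      vb_add E x y \<in> topspace (vb_total E) \<and> f (vb_add E x y) = vb_add F (f x) (f y)"
    and scale: "\<And>c x. x \<in> topspace (vb_total E) \<Longrightarrow>
      vb_scale E c x \<in> topspace (vb_total E) \<and> f (vb_scale E c x) = vb_scale F c (f x)"
    and act: "\<And>\<gamma> x. \<gamma> \<in> cyclic_roots n \<Longrightarrow> x \<in> topspace (vb_total E) \<Longrightarrow>
      vb_act E \<gamma> x \<in> topspace (vb_total E) \<and> f (vb_act E \<gamma> x) = vb_act F \<gamma> (f x)"
  shows "cyclic_vb_equivalent n TYPE('r) E F"
proof -
  let ?E = "vb_total E" and ?F = "vb_total F" and ?B = "vb_base F"
  have F1: "continuous_map ?F ?B (vb_proj F)"
    and F2: "\<And>b x y. b \<in> topspace ?B \<Longrightarrow> x \<in> vb_fibre F b \<Longrightarrow> y \<in> vb_fibre F b \<Longrightarrow> vb_add F x y \<in> vb_fibre F b"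
    and F3: "\<And>b c x. b \<in> topspace ?B \<Longrightarrow> x \<in> vb_fibre F b \<Longrightarrow> vb_scale F c x \<in> vb_fibre F b"
    and F4: "\<And>b. b \<in> topspace ?B \<Longrightarrow> \<exists>U (\<phi> :: 'f \<Rightarrow> 'b \<times> (complex ^ 'r)). openin ?B U \<and> b \<in> U \<and>
        homeomorphic_map (subtopology ?F {x \<in> topspace ?F. vb_proj F x \<in> U})
          (prod_topology (subtopology ?B U) euclidean) \<phi> \<and>
        (\<forall>u\<in>U. \<forall>x\<in>vb_fibre F u.
           fst (\<phi> x) = u \<and>
           (\<forall>y\<in>vb_fibre F u. snd (\<phi> (vb_add F x y)) = snd (\<phi> x) + snd (\<phi> y)) \<and>
           (\<forall>c. snd (\<phi> (vb_scale F c x)) = c *s snd (\<phi> x)))"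
    and actF: "cyclic_space n ?F (vb_act F)" and actB: "cyclic_space n ?B (vb_base_act F)"
    and linF: "\<And>\<gamma>. \<gamma> \<in> cyclic_roots n \<Longrightarrow> vb_linear_over (vb_base_act F \<gamma>) F F (vb_act F \<gamma>)"
    using F unfolding cyclic_vector_bundle_def vector_bundle_def by simp_all
  have fcont: "continuous_map ?E ?F f" and finj: "inj_on f (topspace ?E)" and fim: "f ` topspace ?E = topspace ?F"
    using f by (auto simp: homeomorphic_eq_everything_map)
  have inj: "x = y" if "f x = f y" "x \<in> topspace ?E" "y \<in> topspace ?E" for x y
    using that finj by (auto dest: inj_onD)
  have ft: "f x \<in> topspace ?F" if "x \<in> topspace ?E" for x using fim that by blast
  have fib: "x \<in> vb_fibre E b \<longleftrightarrow> x \<in> topspace ?E \<and> f x \<in> vb_fibre F b" for x b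
    using proj ft by (auto simp: vb_fibre_def)
  have addE: "vb_add E x y \<in> vb_fibre E b \<and> f (vb_add E x y) = vb_add F (f x) (f y)"
    if "b \<in> topspace ?B" "x \<in> vb_fibre E b" "y \<in> vb_fibre E b" for b x y
  proof -
    have "x \<in> topspace ?E" "y \<in> topspace ?E" "vb_proj E x = vb_proj E y"
      using that by (auto simp: vb_fibre_def)
    from add[OF this] show ?thesis using F2[OF that(1)] that by (simp add: fib)
  qed
  have scaleE: "vb_scale E c x \<in> vb_fibre E b \<and> f (vb_scale E c x) = vb_scale F c (f x)"
    if "b \<in> topspace ?B" "x \<in> vb_fibre E b" for b c x
    using that scale F3[OF that(1)] by (simp add: fib)
  have vb: "vector_bundle TYPE('r) E"
    unfolding vector_bundle_def base
  proof (intro conjI ballI allI)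
    show "continuous_map ?E ?B (vb_proj E)"
      by (rule continuous_map_eq[OF continuous_map_compose[OF fcont F1]]) (simp add: proj)
    show "vb_add E x y \<in> vb_fibre E b" if "b \<in> topspace ?B" "x \<in> vb_fibre E b" "y \<in> vb_fibre E b" for b x y
      using addE[OF that] ..
    show "vb_scale E c x \<in> vb_fibre E b" if "b \<in> topspace ?B" "x \<in> vb_fibre E b" for b c x
      using scaleE[OF that] ..
    fix b assume b: "b \<in> topspace ?B"
    obtain U and \<phi> :: "'f \<Rightarrow> 'b \<times> (complex ^ 'r)" where U: "openin ?B U" "b \<in> U"
      and phi: "homeomorphic_map (subtopology ?F {x \<in> topspace ?F. vb_proj F x \<in> U})
          (prod_topology (subtopology ?B U) euclidean) \<phi>"
      and lin: "\<forall>u\<in>U. \<forall>x\<in>vb_fibre F u.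
           fst (\<phi> x) = u \<and>
           (\<forall>y\<in>vb_fibre F u. snd (\<phi> (vb_add F x y)) = snd (\<phi> x) + snd (\<phi> y)) \<and>
           (\<forall>c. snd (\<phi> (vb_scale F c x)) = c *s snd (\<phi> x))"
      using F4[OF b] by (elim exE conjE) (rule that)
    \<comment> \<open>\<open>f\<close> carries the part of \<open>E\<close> over \<open>U\<close>
      onto the part of \<open>F\<close> over \<open>U\<close>, so that
      \<open>\<phi> \<circ> f\<close> is a chart.\<close>
    have "f ` (topspace ?E \<inter> {x \<in> topspace ?E. vb_proj E x \<in> U})
        = topspace ?F \<inter> {x \<in> topspace ?F. vb_proj F x \<in> U}"
      unfolding fim[symmetric] by (auto simp: proj)
    from homeomorphic_map_compose[OF homeomorphic_map_subtopologies[OF f this] phi]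
    have hom: "homeomorphic_map (subtopology ?E {x \<in> topspace ?E. vb_proj E x \<in> U})
        (prod_topology (subtopology ?B U) euclidean) (\<phi> \<circ> f)" .
    have "\<forall>u\<in>U. \<forall>x\<in>vb_fibre E u. fst ((\<phi> \<circ> f) x) = u \<and>
           (\<forall>y\<in>vb_fibre E u. snd ((\<phi> \<circ> f) (vb_add E x y)) = snd ((\<phi> \<circ> f) x) + snd ((\<phi> \<circ> f) y)) \<and>
           (\<forall>c. snd ((\<phi> \<circ> f) (vb_scale E c x)) = c *s snd ((\<phi> \<circ> f) x))"
    proof (intro ballI)
      fix u x assume u: "u \<in> U" and x: "x \<in> vb_fibre E u"
      have uB: "u \<in> topspace ?B" using openin_subset[OF U(1)] u by blast
      have fx: "f y \<in> vb_fibre F u" if "y \<in> vb_fibre E u" for y using that by (simp add: fib)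
      show "fst ((\<phi> \<circ> f) x) = u \<and>
           (\<forall>y\<in>vb_fibre E u. snd ((\<phi> \<circ> f) (vb_add E x y)) = snd ((\<phi> \<circ> f) x) + snd ((\<phi> \<circ> f) y)) \<and>
           (\<forall>c. snd ((\<phi> \<circ> f) (vb_scale E c x)) = c *s snd ((\<phi> \<circ> f) x))"
        using bspec[OF bspec[OF lin u] fx[OF x]] fx addE[OF uB x] scaleE[OF uB x] by simp
    qed
    with U hom show "\<exists>U (\<phi> :: 'e \<Rightarrow> 'b \<times> (complex ^ 'r)). openin ?B U \<and> b \<in> U \<and>
        homeomorphic_map (subtopology ?E {x \<in> topspace ?E. vb_proj E x \<in> U})
          (prod_topology (subtopology ?B U) euclidean) \<phi> \<and>
        (\<forall>u\<in>U. \<forall>x\<in>vb_fibre E u.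
           fst (\<phi> x) = u \<and>
           (\<forall>y\<in>vb_fibre E u. snd (\<phi> (vb_add E x y)) = snd (\<phi> x) + snd (\<phi> y)) \<and>
           (\<forall>c. snd (\<phi> (vb_scale E c x)) = c *s snd (\<phi> x)))"
      by (intro exI[of _ U] exI[of _ "\<phi> \<circ> f"] conjI)
  qed
  have acts: "cyclic_space n ?E (vb_act E)"
    unfolding cyclic_space_def
  proof (intro conjI ballI)
    obtain g where g: "homeomorphic_maps ?E ?F f g" using f homeomorphic_map_maps by blast
    then have gcont: "continuous_map ?F ?E g" and gf: "\<And>x. x \<in> topspace ?E \<Longrightarrow> g (f x) = x"
      by (auto simp: homeomorphic_maps_def)
    fix \<gamma> assume \<gamma>: "\<gamma> \<in> cyclic_roots n"
    then have "continuous_map ?F ?F (vb_act F \<gamma>)" using actF by (simp add: cyclic_space_def)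
    \<comment> \<open>The action on \<open>E\<close> is the action on \<open>F\<close> conjugated by
      \<open>f\<close>, hence a composite of continuous maps.\<close>
    from continuous_map_compose[OF continuous_map_compose[OF fcont this] gcont]
    show "continuous_map ?E ?E (vb_act E \<gamma>)"
    proof (rule continuous_map_eq)
      fix x assume "x \<in> topspace ?E"
      with act[OF \<gamma>, of x] gf[of "vb_act E \<gamma> x"] show "(g \<circ> (vb_act F \<gamma> \<circ> f)) x = vb_act E \<gamma> x" by simp
    qed
    fix \<delta> x assume \<delta>: "\<delta> \<in> cyclic_roots n" and x: "x \<in> topspace ?E"
    have \<gamma>\<delta>: "\<gamma> * \<delta> \<in> cyclic_roots n" using \<gamma> \<delta> by (simp add: cyclic_roots_def power_mult_distrib)
    show "vb_act E (\<gamma> * \<delta>) x = vb_act E \<gamma> (vb_act E \<delta> x)"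
    proof (rule inj)
      show "f (vb_act E (\<gamma> * \<delta>) x) = f (vb_act E \<gamma> (vb_act E \<delta> x))"
        using act[OF \<gamma>\<delta> x] act[OF \<delta> x] act[OF \<gamma>, of "vb_act E \<delta> x"] actF ft[OF x] \<gamma> \<delta>
        by (simp add: cyclic_space_def)
    qed (use act \<gamma> \<delta> \<gamma>\<delta> x in blast)+
  next
    fix x assume x: "x \<in> topspace ?E"
    have 1: "1 \<in> cyclic_roots n" by (simp add: cyclic_roots_def)
    show "vb_act E 1 x = x"
      by (rule inj) (use act[OF 1 x] actF ft[OF x] x in \<open>simp_all add: cyclic_space_def\<close>)
  qed
  have lins: "vb_linear_over (vb_base_act F \<gamma>) E E (vb_act E \<gamma>)" if \<gamma>: "\<gamma> \<in> cyclic_roots n" for \<gamma>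
    unfolding vb_linear_over_def base
  proof (intro ballI)
    fix b x assume b: "b \<in> topspace ?B" and x: "x \<in> vb_fibre E b"
    let ?b = "vb_base_act F \<gamma> b"
    have "continuous_map ?B ?B (vb_base_act F \<gamma>)" using actB \<gamma> by (simp add: cyclic_space_def)
    then have b': "?b \<in> topspace ?B" using b continuous_map_image_subset_topspace by blast
    have lin: "vb_act F \<gamma> (f y) \<in> vb_fibre F ?b"
       "vb_act F \<gamma> (vb_add F (f y) (f z)) = vb_add F (vb_act F \<gamma> (f y)) (vb_act F \<gamma> (f z))"
       "vb_act F \<gamma> (vb_scale F c (f y)) = vb_scale F c (vb_act F \<gamma> (f y))"
      if "y \<in> vb_fibre E b" "z \<in> vb_fibre E b" for y z c
      using linF[OF \<gamma>] b that unfolding vb_linear_over_def by (auto simp: fib)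
    have actE: "vb_act E \<gamma> y \<in> vb_fibre E ?b" if "y \<in> vb_fibre E b" for y
      using lin(1)[OF that that] act[OF \<gamma>, of y] that by (simp add: fib)
    have "vb_act E \<gamma> (vb_add E x y) = vb_add E (vb_act E \<gamma> x) (vb_act E \<gamma> y)" if y: "y \<in> vb_fibre E b" for y
    proof (rule inj)
      have t: "x \<in> topspace ?E" "y \<in> topspace ?E" "vb_add E x y \<in> topspace ?E"
        using x y addE[OF b x y] by (simp_all add: fib)
      show "f (vb_act E \<gamma> (vb_add E x y)) = f (vb_add E (vb_act E \<gamma> x) (vb_act E \<gamma> y))"
        using act[OF \<gamma> t(1)] act[OF \<gamma> t(2)] act[OF \<gamma> t(3)] addE[OF b x y] lin(2)[OF x y]
          addE[OF b' actE[OF x] actE[OF y]] by simp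
      show "vb_act E \<gamma> (vb_add E x y) \<in> topspace ?E" using act[OF \<gamma> t(3)] ..
      show "vb_add E (vb_act E \<gamma> x) (vb_act E \<gamma> y) \<in> topspace ?E"
        using addE[OF b' actE[OF x] actE[OF y]] by (simp add: fib)
    qed
    moreover have "vb_act E \<gamma> (vb_scale E c x) = vb_scale E c (vb_act E \<gamma> x)" for c
    proof (rule inj)
      have t: "x \<in> topspace ?E" "vb_scale E c x \<in> topspace ?E"
        using x scaleE[OF b x] by (simp_all add: fib)
      show "f (vb_act E \<gamma> (vb_scale E c x)) = f (vb_scale E c (vb_act E \<gamma> x))"
        using act[OF \<gamma> t(1)] act[OF \<gamma> t(2)] scaleE[OF b x] lin(3)[OF x x]
          scaleE[OF b' actE[OF x]] by simp
      show "vb_act E \<gamma> (vb_scale E c x) \<in> topspace ?E" using act[OF \<gamma> t(2)] ..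
      show "vb_scale E c (vb_act E \<gamma> x) \<in> topspace ?E"
        using scaleE[OF b' actE[OF x]] by (simp add: fib)
    qed
    ultimately show "vb_act E \<gamma> x \<in> vb_fibre E ?b \<and>
        (\<forall>y\<in>vb_fibre E b. vb_act E \<gamma> (vb_add E x y) = vb_add E (vb_act E \<gamma> x) (vb_act E \<gamma> y)) \<and>
        (\<forall>c. vb_act E \<gamma> (vb_scale E c x) = vb_scale E c (vb_act E \<gamma> x))"
      using actE[OF x] by blast
  qed
  have "cyclic_vector_bundle n TYPE('r) E"
    unfolding cyclic_vector_bundle_def base using vb acts actB lins by blast
  moreover have "vb_linear_over id E F f"
    unfolding vb_linear_over_def base using addE scaleE by (auto simp: fib)
  ultimately show ?thesis
    unfolding cyclic_vb_equivalent_def using F base f act by auto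
qed

section \<open>Operations of the associated bundle and the equivalence\<close>

abbreviation associated_stiefel :: "((((nat \<Rightarrow> complex) ^ 'r) \<times> (complex ^ 'r)) set, (nat \<Rightarrow> complex) set) vb_data" where
  "associated_stiefel \<equiv> associated_bundle (stiefel_bundle :: (_, _, 'r::finite) principal_data)"

text \<open>For the nontrivial inclusion a representative \<open>(v, w)\<close> of the sum is split
  over the same frame: with \<open>y\<close> the coordinates of \<open>z\<close> in
  \<open>v\<close>, linearity makes \<open>w - y\<close> represent \<open>z'\<close>.\<close>

lemma associated_add:
  fixes N :: "(nat \<Rightarrow> complex) set"
  assumes "z \<in> N"
  shows "vb_add associated_stiefel (frame_vector_fibre (N, z)) (frame_vector_fibre (N, z'))
    = (frame_vector_fibre (N, z + z') :: (((nat \<Rightarrow> complex) ^ 'r::finite) \<times> (complex ^ 'r)) set)"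
proof (intro set_eqI iffI)
  fix x :: "((nat \<Rightarrow> complex) ^ 'r) \<times> (complex ^ 'r)"
  assume "x \<in> vb_add associated_stiefel (frame_vector_fibre (N, z)) (frame_vector_fibre (N, z'))"
  then show "x \<in> frame_vector_fibre (N, z + z')"
    by (auto simp: associated_bundle_def mem_frame_vector_fibre frame_comb_add)
next
  fix x :: "((nat \<Rightarrow> complex) ^ 'r) \<times> (complex ^ 'r)"
  assume "x \<in> frame_vector_fibre (N, z + z')"
  then obtain v w where x: "x = (v, w)" "v \<in> stiefel_set" "frame_span v = N" "frame_comb v w = z + z'"
    by (cases x) (auto simp: mem_frame_vector_fibre)
  define y where "y = frame_coords v z"
  have y: "frame_comb v y = z" using x assms by (simp add: y_def frame_comb_coords)
  have "frame_comb v y + frame_comb v (w - y) = frame_comb v w"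
    by (simp flip: frame_comb_add)
  then have "frame_comb v (w - y) = z'" using x y by simp
  then have "(v, y) \<in> frame_vector_fibre (N, z)" "(v, w - y) \<in> frame_vector_fibre (N, z')"
    using x y by (simp_all add: mem_frame_vector_fibre)
  moreover have "x = (v, y + (w - y))" using x by simp
  ultimately show "x \<in> vb_add associated_stiefel (frame_vector_fibre (N, z)) (frame_vector_fibre (N, z'))"
    unfolding associated_bundle_def vb_data.simps by blast
qed

text \<open>The coordinates \<open>y\<close> of \<open>z\<close> are taken first and
  \<open>w = c *s y\<close> follows from their uniqueness; dividing \<open>w\<close> by
  \<open>c\<close> would exclude \<open>c = 0\<close>.\<close>

lemma associated_scale:
  fixes N :: "(nat \<Rightarrow> complex) set"
  assumes "z \<in> N"
  shows "vb_scale associated_stiefel c (frame_vector_fibre (N, z))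
    = (frame_vector_fibre (N, cscale c z) :: (((nat \<Rightarrow> complex) ^ 'r::finite) \<times> (complex ^ 'r)) set)"
proof (intro set_eqI iffI)
  fix x :: "((nat \<Rightarrow> complex) ^ 'r) \<times> (complex ^ 'r)"
  assume "x \<in> vb_scale associated_stiefel c (frame_vector_fibre (N, z))"
  then show "x \<in> frame_vector_fibre (N, cscale c z)"
    by (auto simp: associated_bundle_def mem_frame_vector_fibre frame_comb_scale)
next
  fix x :: "((nat \<Rightarrow> complex) ^ 'r) \<times> (complex ^ 'r)"
  assume "x \<in> frame_vector_fibre (N, cscale c z)"
  then obtain v w where x: "x = (v, w)" "v \<in> stiefel_set" "frame_span v = N" "frame_comb v w = cscale c z"
    by (cases x) (auto simp: mem_frame_vector_fibre)
  define y where "y = frame_coords v z"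
  have y: "frame_comb v y = z" using x assms by (simp add: y_def frame_comb_coords)
  have "frame_comb v w = frame_comb v (c *s y)" using x y by (simp add: frame_comb_scale)
  then have "w = c *s y" using frame_coords_comb[OF x(2)] by metis
  moreover have "(v, y) \<in> frame_vector_fibre (N, z)" using x y by (simp add: mem_frame_vector_fibre)
  ultimately show "x \<in> vb_scale associated_stiefel c (frame_vector_fibre (N, z))"
    using x(1) unfolding associated_bundle_def vb_data.simps by blast
qed

lemma associated_act:
  fixes N :: "(nat \<Rightarrow> complex) set"
  assumes \<gamma>: "\<gamma> * cnj \<gamma> = 1"
  shows "vb_act associated_stiefel \<gamma> (frame_vector_fibre (N, z))
    = (frame_vector_fibre (module_act \<gamma> ` N, module_act \<gamma> z) :: (((nat \<Rightarrow> complex) ^ 'r) \<times> (complex ^ 'r::finite)) set)"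
proof (intro set_eqI iffI)
  have st: "stiefel_act \<delta> (mat 1) v \<in> stiefel_set"
    if "v \<in> stiefel_set" "\<delta> * cnj \<delta> = 1" for v :: "(nat \<Rightarrow> complex) ^ 'r" and \<delta>
    using continuous_map_image_subset_topspace[OF continuous_map_stiefel_act[OF that(2)]] that(1) by blast
  {
    fix x :: "((nat \<Rightarrow> complex) ^ 'r) \<times> (complex ^ 'r)"
    assume "x \<in> vb_act associated_stiefel \<gamma> (frame_vector_fibre (N, z))"
    then obtain v y where "x = (stiefel_act \<gamma> (mat 1) v, y)" "(v, y) \<in> frame_vector_fibre (N, z)"
      by (auto simp: associated_bundle_def stiefel_bundle_def)
    then show "x \<in> frame_vector_fibre (module_act \<gamma> ` N, module_act \<gamma> z)"
      using st \<gamma> by (simp add: mem_frame_vector_fibre module_act_frame_comb flip: module_act_frame_span)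
  }
  fix x :: "((nat \<Rightarrow> complex) ^ 'r) \<times> (complex ^ 'r)"
  assume "x \<in> frame_vector_fibre (module_act \<gamma> ` N, module_act \<gamma> z)"
  then obtain v y where x: "x = (v, y)" "v \<in> stiefel_set" "frame_span v = module_act \<gamma> ` N"
    "frame_comb v y = module_act \<gamma> z"
    by (cases x) (auto simp: mem_frame_vector_fibre)
  \<comment> \<open>As \<open>\<gamma>\<close> has modulus one, \<open>cnj \<gamma>\<close> is its
    inverse, and moving the frame back by it produces the required preimage.\<close>
  let ?v = "stiefel_act (cnj \<gamma>) (mat 1) v"
  have inv: "module_act (cnj \<gamma>) (module_act \<gamma> w) = w" "module_act \<gamma> (module_act (cnj \<gamma>) w) = w" for w
    using \<gamma> by (simp_all flip: module_act_mult add: module_act_1 mult.commute)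
  have "?v \<in> stiefel_set" using st x(2) \<gamma> by (simp add: mult.commute)
  moreover have "frame_span ?v = N"
    using x(3) by (simp add: image_image inv flip: module_act_frame_span)
  moreover have "frame_comb ?v y = z"
    using x(4) by (simp add: module_act_frame_comb inv)
  ultimately have "(?v, y) \<in> frame_vector_fibre (N, z)" by (simp add: mem_frame_vector_fibre)
  moreover have "v = stiefel_act \<gamma> (mat 1) ?v"
    by (simp add: stiefel_act_mat_1 inv)
  ultimately show "x \<in> vb_act associated_stiefel \<gamma> (frame_vector_fibre (N, z))"
    using x(1) by (auto simp: associated_bundle_def stiefel_bundle_def)
qed

text \<open>All frames in a class span the same subspace and the class is nonempty, so
  \<open>the_elem\<close> in the definition of the projection is applied to a singleton.\<close>

lemma associated_proj:
  assumes "(N, z) \<in> topspace (canonical_space TYPE('r::finite))"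
  shows "vb_proj associated_stiefel (frame_vector_fibre (N, z) :: (((nat \<Rightarrow> complex) ^ 'r) \<times> (complex ^ 'r)) set) = N"
proof -
  obtain x :: "((nat \<Rightarrow> complex) ^ 'r) \<times> (complex ^ 'r)" where "x \<in> frame_vector_fibre (N, z)"
    using frame_vector_fibre_nonempty[OF assms] .
  then have "(\<lambda>(v, y). frame_span v) ` (frame_vector_fibre (N, z) :: (((nat \<Rightarrow> complex) ^ 'r) \<times> (complex ^ 'r)) set) = {N}"
    by (cases x) (force simp: mem_frame_vector_fibre)
  then show ?thesis by (simp add: associated_bundle_def stiefel_bundle_def)
qed

lemma associated_equivalent_canonical:
  assumes n: "n \<ge> 1"
  shows "cyclic_vb_equivalent n TYPE('r::finite)
    (associated_bundle (stiefel_bundle :: (_, _, 'r) principal_data)) (canonical_bundle TYPE('r))"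
proof -
  let ?S = "associated_bundle (stiefel_bundle :: (_, _, 'r) principal_data)"
  let ?C = "canonical_space TYPE('r)" and ?A = "associated_space TYPE('r)"
  \<comment> \<open>An explicit inverse of \<open>frame_vector_fibre\<close>: all representatives in
    a class have the same image under \<open>frame_vector\<close>.\<close>
  define f where "f C = the_elem (frame_vector ` C)" for C :: "(((nat \<Rightarrow> complex) ^ 'r) \<times> (complex ^ 'r)) set"
  have f: "f (frame_vector_fibre p) = p" if "p \<in> topspace ?C" for p
    using image_frame_vector_fibre[OF that] by (simp add: f_def)
  have top: "topspace ?A = frame_vector_fibre ` topspace ?C"
    using homeomorphic_imp_surjective_map[OF homeomorphic_map_fibre[where 'r = 'r]] by simp
  \<comment> \<open>The inverse \<open>g\<close> is known only to exist; its agreement with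
    \<open>f\<close> on the associated space makes \<open>f\<close> a homeomorphism.\<close>
  obtain g where g: "homeomorphic_maps ?C ?A frame_vector_fibre g"
    using homeomorphic_map_fibre[where 'r = 'r] homeomorphic_map_maps by blast
  then have "homeomorphic_map ?A ?C g"
    using homeomorphic_maps_sym homeomorphic_maps_imp_map by blast
  moreover have "g x = f x" if x: "x \<in> topspace ?A" for x
  proof -
    obtain p where p: "p \<in> topspace ?C" "x = frame_vector_fibre p" using x top by auto
    with g f show ?thesis by (simp add: homeomorphic_maps_def)
  qed
  ultimately have hom: "homeomorphic_map ?A ?C f" by (rule homeomorphic_map_eq)
  have cases: thesis if "x \<in> topspace ?A"
    "\<And>N z. x = frame_vector_fibre (N, z) \<Longrightarrow> (N, z) \<in> topspace ?C \<Longrightarrow>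
       N \<in> grassmannian_set TYPE('r) \<Longrightarrow> z \<in> N \<Longrightarrow> cseq.subspace N \<Longrightarrow> thesis"
    for x thesis
  proof -
    have "x \<in> frame_vector_fibre ` topspace ?C" using that(1) by (simp only: top)
    then obtain p where "p \<in> topspace ?C" "x = frame_vector_fibre p" by (rule imageE)
    moreover obtain N z where "p = (N, z)" by (rule prod.exhaust)
    ultimately have "x = frame_vector_fibre (N, z)" "(N, z) \<in> topspace ?C" by simp_all
    moreover from this(2) have "N \<in> grassmannian_set TYPE('r)" "z \<in> N"
      unfolding topspace_canonical_space by auto
    moreover from this(1) have "cseq.subspace N" by (simp add: grassmannian_set_def)
    ultimately show thesis by (rule that(2))
  qed
  show ?thesis
  proof (rule cyclic_vb_equivalentI[where f = f])
    show "cyclic_vector_bundle n TYPE('r) (canonical_bundle TYPE('r))"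
      by (rule cyclic_vector_bundle_canonical[OF n])
    show "vb_base ?S = vb_base (canonical_bundle TYPE('r))"
      "vb_base_act ?S = vb_base_act (canonical_bundle TYPE('r))"
      by (simp_all add: associated_bundle_def canonical_bundle_def stiefel_bundle_def)
    show "homeomorphic_map ?A (vb_total (canonical_bundle TYPE('r))) f"
      using hom by (simp add: canonical_bundle_def)
    show "vb_proj (canonical_bundle TYPE('r)) (f x) = vb_proj ?S x" if "x \<in> topspace ?A" for x
      using that
    proof (rule cases)
      fix N z assume x: "x = frame_vector_fibre (N, z)" "(N, z) \<in> topspace ?C"
      then show ?thesis using f[OF x(2)] associated_proj[OF x(2)] by (simp add: canonical_bundle_def)
    qed
    show "vb_add ?S x y \<in> topspace ?A \<and>
        f (vb_add ?S x y) = vb_add (canonical_bundle TYPE('r)) (f x) (f y)"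
      if "x \<in> topspace ?A" "y \<in> topspace ?A" "vb_proj ?S x = vb_proj ?S y" for x y
      using that(1)
    proof (rule cases)
      fix N z assume x: "x = frame_vector_fibre (N, z)" "(N, z) \<in> topspace ?C"
        and N: "N \<in> grassmannian_set TYPE('r)" "z \<in> N" "cseq.subspace N"
      show ?thesis
        using that(2)
      proof (rule cases)
        fix N' z' assume y: "y = frame_vector_fibre (N', z')" "(N', z') \<in> topspace ?C" "z' \<in> N'"
        have "N' = N" using that(3) associated_proj[OF x(2)] associated_proj[OF y(2)] x(1) y(1) by simp
        with y N have t: "(N, z + z') \<in> topspace ?C"
          unfolding topspace_canonical_space by (simp add: cseq.subspace_add)
        show ?thesis
          unfolding x(1) y(1) \<open>N' = N\<close> associated_add[OF N(2)]
          using f[OF t] f[OF x(2)] f[OF y(2)] \<open>N' = N\<close> t top by (simp add: canonical_bundle_def)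
      qed
    qed
    show "vb_scale ?S c x \<in> topspace ?A \<and>
        f (vb_scale ?S c x) = vb_scale (canonical_bundle TYPE('r)) c (f x)"
      if "x \<in> topspace ?A" for c x
      using that
    proof (rule cases)
      fix N z assume x: "x = frame_vector_fibre (N, z)" "(N, z) \<in> topspace ?C"
        and N: "N \<in> grassmannian_set TYPE('r)" "z \<in> N" "cseq.subspace N"
      have t: "(N, cscale c z) \<in> topspace ?C"
        unfolding topspace_canonical_space using N by (simp add: cseq.subspace_scale)
      show ?thesis
        unfolding x(1) associated_scale[OF N(2)]
        using f[OF t] f[OF x(2)] t top by (simp add: canonical_bundle_def)
    qed
    show "vb_act ?S \<gamma> x \<in> topspace ?A \<and>
        f (vb_act ?S \<gamma> x) = vb_act (canonical_bundle TYPE('r)) \<gamma> (f x)"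
      if \<gamma>: "\<gamma> \<in> cyclic_roots n" and "x \<in> topspace ?A" for \<gamma> x
      using that(2)
    proof (rule cases)
      fix N z assume x: "x = frame_vector_fibre (N, z)" "(N, z) \<in> topspace ?C"
      have "continuous_map ?C ?C (\<lambda>(N, z). (module_act \<gamma> ` N, module_act \<gamma> z))"
        using cyclic_space_canonical[OF n, where 'r = 'r] \<gamma> by (simp add: cyclic_space_def)
      from continuous_map_image_subset_topspace[OF this] x(2)
      have t: "(module_act \<gamma> ` N, module_act \<gamma> z) \<in> topspace ?C" by blast
      show ?thesis
        unfolding x(1) associated_act[OF cyclic_roots_cnj[OF n \<gamma>]]
        using f[OF t] f[OF x(2)] t top by (simp add: canonical_bundle_def)
    qed
  qed
qed

theorem theorem2:
  fixes n :: nat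
  assumes "n \<ge> 1"
  shows "cyclic_principal_bundle n
           (stiefel_bundle :: ((nat \<Rightarrow> complex) ^ 'r, (nat \<Rightarrow> complex) set, 'r::finite) principal_data) \<and>
         cyclic_vb_equivalent n TYPE('r)
           (associated_bundle
             (stiefel_bundle :: ((nat \<Rightarrow> complex) ^ 'r, (nat \<Rightarrow> complex) set, 'r) principal_data))
           (canonical_bundle TYPE('r))"
  using cyclic_principal_bundle_stiefel[OF assms] associated_equivalent_canonical[OF assms] by blast

end
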